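(* Let $\alpha>1$, $\beta=\alpha-1$ and $\mu_0,\mu_1\in\mathcal{P}_2(\mathbb{R}^d)$, and set $\mathcal{F}(\mu_0,\mu_1;\rho):=\alpha W_2^2(\rho,\mu_1)-\beta W_2^2(\rho,\mu_0)$ for $\rho\in\mathcal{P}_2(\mathbb{R}^d)$. The metric extrapolation problem $$\min_{\rho\in\mathcal{P}_2(\mathbb{R}^d)}\mathcal{F}(\mu_0,\mu_1;\rho)$$ admits a unique solution $\mu_\alpha$. Moreover, the metric extrapolation is $\beta$-dissipative, i.e. $$W_2(\mu_1,\mu_\alpha)\le\beta\,W_2(\mu_0,\mu_1),$$ and for all $\mu\in\mathcal{P}_2(\mathbb{R}^d)$, $$W_2^2(\mu,\mu_\alpha)+\mathcal{F}(\mu_0,\mu_1;\mu_\alpha)\le\mathcal{F}(\mu_0,\mu_1;\mu).$$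
   Context: $\mathcal{P}_2(\mathbb{R}^d)$ is the set of probability measures on $\mathbb{R}^d$ with finite second moment and $W_2$ is the quadratic Wasserstein distance. *)

theory Defs
  imports "HOL-Probability.Probability"
begin

definition P2 :: "'a::euclidean_space measure set" where
  "P2 = {\<mu>. prob_space \<mu> \<and> sets \<mu> = sets borel \<and> integrable \<mu> (\<lambda>x. (norm x)\<^sup>2)}"

definition couplings :: "'a::euclidean_space measure \<Rightarrow> 'a measure \<Rightarrow> ('a \<times> 'a) measure set" where
  "couplings \<mu> \<nu> = {\<pi>. prob_space \<pi> \<and> sets \<pi> = sets borel \<and>
     distr \<pi> borel fst = \<mu> \<and> distr \<pi> borel snd = \<nu>}"

definition transport_cost :: "('a::euclidean_space \<times> 'a) measure \<Rightarrow> ennreal" where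
  "transport_cost \<pi> = (\<integral>\<^sup>+z. ennreal ((dist (fst z) (snd z))\<^sup>2) \<partial>\<pi>)"

(* The infimum is finite for mu, nu in P2 (see W2_cost_finite below), so enn2real
   loses nothing there. Outside P2 the value is not meaningful. *)
definition W2 :: "'a::euclidean_space measure \<Rightarrow> 'a measure \<Rightarrow> real" where
  "W2 \<mu> \<nu> = sqrt (enn2real (INF \<pi>\<in>couplings \<mu> \<nu>. transport_cost \<pi>))"

definition extrapolation_functional ::
  "real \<Rightarrow> real \<Rightarrow> 'a::euclidean_space measure \<Rightarrow> 'a measure \<Rightarrow> 'a measure \<Rightarrow> real" where
  "extrapolation_functional \<alpha> \<beta> \<mu>0 \<mu>1 \<rho> = \<alpha> * (W2 \<rho> \<mu>1)\<^sup>2 - \<beta> * (W2 \<rho> \<mu>0)\<^sup>2"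

definition is_metric_extrapolation ::
  "real \<Rightarrow> real \<Rightarrow> 'a::euclidean_space measure \<Rightarrow> 'a measure \<Rightarrow> 'a measure \<Rightarrow> bool" where
  "is_metric_extrapolation \<alpha> \<beta> \<mu>0 \<mu>1 \<rho> \<longleftrightarrow>
     is_arg_min (extrapolation_functional \<alpha> \<beta> \<mu>0 \<mu>1) (\<lambda>\<rho>. \<rho> \<in> P2) \<rho>"

lemma W2_cost_finite:
  fixes \<mu> \<nu> :: "'a::euclidean_space measure"
  assumes "\<mu> \<in> P2" "\<nu> \<in> P2"
  shows "(INF \<pi>\<in>couplings \<mu> \<nu>. transport_cost \<pi>) < \<infinity>"
proof -
  interpret M: prob_space \<mu> using assms by (simp add: P2_def)
  interpret N: prob_space \<nu> using assms by (simp add: P2_def)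
  interpret MN: pair_prob_space \<mu> \<nu> ..
  have S [measurable_cong]: "sets \<mu> = sets borel" "sets \<nu> = sets borel"
    and I: "integrable \<mu> (\<lambda>x. (norm x)\<^sup>2)" "integrable \<nu> (\<lambda>x. (norm x)\<^sup>2)"
    using assms by (auto simp: P2_def)
  let ?p = "\<mu> \<Otimes>\<^sub>M \<nu>"
  have sp: "sets ?p = sets borel"
    by (metis S sets_pair_measure_cong borel_prod)
  have f: "distr ?p borel fst = \<mu>"
  proof -
    have "distr ?p borel fst = distr ?p \<mu> fst"
      by (rule distr_cong) (simp_all add: S)
    also have "\<dots> = \<mu>" by (rule N.distr_pair_fst)
    finally show ?thesis .
  qed
  have s: "distr ?p borel snd = \<nu>"
  proof (rule measure_eqI)
    show "sets (distr ?p borel snd) = sets \<nu>" by (simp add: S)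
    fix A assume "A \<in> sets (distr ?p borel snd)"
    then have A: "A \<in> sets \<nu>" by (simp add: S)
    have "emeasure (distr ?p borel snd) A = emeasure ?p (snd -` A \<inter> space ?p)"
      using A by (intro emeasure_distr) (simp_all add: S)
    also have "snd -` A \<inter> space ?p = space \<mu> \<times> A"
      using sets.sets_into_space[OF A] by (auto simp: space_pair_measure)
    also have "emeasure ?p \<dots> = emeasure \<nu> A"
      using A by (simp add: N.emeasure_pair_measure_Times M.emeasure_space_1)
    finally show "emeasure (distr ?p borel snd) A = emeasure \<nu> A" .
  qed
  have c: "?p \<in> couplings \<mu> \<nu>"
    using sp f s MN.prob_space_axioms by (simp add: couplings_def)
  have fin: "(\<integral>\<^sup>+x. ennreal ((norm x)\<^sup>2) \<partial>\<mu>) < \<infinity>" "(\<integral>\<^sup>+x. ennreal ((norm x)\<^sup>2) \<partial>\<nu>) < \<infinity>"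
    using I by (simp_all add: integrable_iff_bounded)
  have "transport_cost ?p \<le> (\<integral>\<^sup>+z. ennreal (2 * (norm (fst z))\<^sup>2) + ennreal (2 * (norm (snd z))\<^sup>2) \<partial>?p)"
    unfolding transport_cost_def
  proof (rule nn_integral_mono)
    fix z :: "'a \<times> 'a"
    have "(dist (fst z) (snd z))\<^sup>2 \<le> (norm (fst z) + norm (snd z))\<^sup>2"
      by (intro power_mono) (simp_all add: dist_norm norm_triangle_ineq4)
    also have "\<dots> \<le> 2 * (norm (fst z))\<^sup>2 + 2 * (norm (snd z))\<^sup>2"
      using sum_squares_bound[of "norm (fst z)" "norm (snd z)"] by (simp add: power2_sum)
    finally show "ennreal ((dist (fst z) (snd z))\<^sup>2)
        \<le> ennreal (2 * (norm (fst z))\<^sup>2) + ennreal (2 * (norm (snd z))\<^sup>2)"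
      by (simp flip: ennreal_plus)
  qed
  also have "\<dots> = (\<integral>\<^sup>+z. ennreal (2 * (norm (fst z))\<^sup>2) \<partial>?p) + (\<integral>\<^sup>+z. ennreal (2 * (norm (snd z))\<^sup>2) \<partial>?p)"
    by (rule nn_integral_add) measurable
  also have "(\<integral>\<^sup>+z. ennreal (2 * (norm (fst z))\<^sup>2) \<partial>?p)
      = (\<integral>\<^sup>+x. ennreal (2 * (norm x)\<^sup>2) \<partial>distr ?p borel fst)"
    by (subst nn_integral_distr) measurable
  also have "(\<integral>\<^sup>+z. ennreal (2 * (norm (snd z))\<^sup>2) \<partial>?p)
      = (\<integral>\<^sup>+x. ennreal (2 * (norm x)\<^sup>2) \<partial>distr ?p borel snd)"
    by (subst nn_integral_distr) measurable
  also have "(\<integral>\<^sup>+x. ennreal (2 * (norm x)\<^sup>2) \<partial>distr ?p borel fst)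
      + (\<integral>\<^sup>+x. ennreal (2 * (norm x)\<^sup>2) \<partial>distr ?p borel snd) < \<infinity>"
    using fin unfolding f s
    by (simp add: ennreal_mult nn_integral_cmult ennreal_mult_less_top S)
  finally have "transport_cost ?p < \<infinity>" .
  with c show ?thesis by (meson INF_lower le_less_trans)
qed

end

theory Submission
  imports Defs
begin

text \<open>
  For \<open>X\<^sub>t = (1 - t) X\<^sub>0 + t X\<^sub>1\<close> the identity
  \<open>|X\<^sub>t - Y|\<^sup>2 + t (1 - t) |X\<^sub>0 - X\<^sub>1|\<^sup>2 = (1 - t) |X\<^sub>0 - Y|\<^sup>2 + t |X\<^sub>1 - Y|\<^sup>2\<close> is used twice.
  If \<open>(X\<^sub>0, Y)\<close> and \<open>(X\<^sub>1, Y)\<close> are nearly optimal and \<open>Y\<close> has law \<open>\<mu>1\<close>, it bounds the squared distance of the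
  law of \<open>X\<^sub>t\<close> to \<open>\<mu>1\<close> from above; if \<open>(X\<^sub>t, Y)\<close> is nearly optimal and \<open>Y\<close> has law \<open>\<mu>0\<close>, it bounds the one
  to \<open>\<mu>0\<close> from below. As \<open>\<alpha> - \<beta> = 1\<close>, the functional is 2-convex along such curves, up to an
  arbitrary error. Hence minimizing sequences are Cauchy, and the Wasserstein space is complete.
  Comparing a minimizer with points of the curve as \<open>t\<close> tends to 0 gives the variational inequality,
  which yields uniqueness and, tested at \<open>\<mu>1\<close>, dissipativity.

  Optimal plans and disintegration are avoided: nearly optimal plans suffice, and these can be chosen
  to be given by explicit Markov kernels, which compose.
\<close>

section \<open>Couplings and elementary properties of the Wasserstein distance\<close>

lemma borel_measurable_fst_snd [measurable]:
  "(fst :: 'a::topological_space \<times> 'b::topological_space \<Rightarrow> 'a) \<in> borel_measurable borel"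
  "(snd :: 'a::topological_space \<times> 'b::topological_space \<Rightarrow> 'b) \<in> borel_measurable borel"
  by (auto intro!: borel_measurable_continuous_onI continuous_intros)

lemma W2_nonneg: "0 \<le> W2 \<mu> \<nu>"
  by (simp add: W2_def)

lemma W2_power2: "(W2 \<mu> \<nu>)\<^sup>2 = enn2real (INF \<pi>\<in>couplings \<mu> \<nu>. transport_cost \<pi>)"
  by (simp add: W2_def)

lemma P2D:
  assumes "\<mu> \<in> P2"
  shows "prob_space \<mu>" "sets \<mu> = sets borel" "space \<mu> = UNIV"
    "(\<integral>\<^sup>+x. ennreal ((norm x)\<^sup>2) \<partial>\<mu>) < \<infinity>"
  using assms sets_eq_imp_space_eq[of \<mu> borel] by (auto simp: P2_def integrable_iff_bounded)

text \<open>The joint law of \<open>X\<close> and \<open>Y\<close> is a coupling of their laws. This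
  is how every upper bound on \<open>W2\<close> is obtained: it suffices to exhibit two random
  variables on some probability space.\<close>

lemma W2_power2_le:
  fixes X Y :: "'b \<Rightarrow> 'a::euclidean_space"
  assumes "prob_space M" and [measurable]: "X \<in> borel_measurable M" "Y \<in> borel_measurable M"
  shows "ennreal ((W2 (distr M borel X) (distr M borel Y))\<^sup>2)
    \<le> (\<integral>\<^sup>+\<omega>. ennreal ((dist (X \<omega>) (Y \<omega>))\<^sup>2) \<partial>M)"
proof -
  let ?\<pi> = "distr M borel (\<lambda>\<omega>. (X \<omega>, Y \<omega>))"
  let ?I = "INF \<pi>\<in>couplings (distr M borel X) (distr M borel Y). transport_cost \<pi>"
  interpret prob_space M by fact
  have "?\<pi> \<in> couplings (distr M borel X) (distr M borel Y)"
    by (simp add: couplings_def distr_distr o_def prob_space_distr)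
  then have "?I \<le> transport_cost ?\<pi>"
    by (rule INF_lower)
  also have "\<dots> = (\<integral>\<^sup>+\<omega>. ennreal ((dist (X \<omega>) (Y \<omega>))\<^sup>2) \<partial>M)"
    unfolding transport_cost_def by (subst nn_integral_distr) auto
  \<comment> \<open>\<open>enn2real\<close> maps infinity to 0 and fixes all finite values, so it
    can only lower the infimum.\<close>
  finally show ?thesis
    unfolding W2_power2 by (metis ennreal_enn2real_if order_trans zero_le order_refl)
qed

text \<open>On \<open>P2\<close> the infimum is finite, so \<open>enn2real\<close> can be undone; a
  bound strictly above an infimum is met by some element. Nearly optimal plans enter the later
  arguments in this way.\<close>

lemma W2_coupling:
  assumes "\<mu> \<in> P2" "\<nu> \<in> P2" "W2 \<mu> \<nu> < c"
  obtains \<pi> where "\<pi> \<in> couplings \<mu> \<nu>" "transport_cost \<pi> \<le> ennreal (c\<^sup>2)"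
proof -
  let ?I = "INF \<pi>\<in>couplings \<mu> \<nu>. transport_cost \<pi>"
  have "enn2real ?I < c\<^sup>2"
    using assms(3) W2_nonneg[of \<mu> \<nu>] by (simp flip: W2_power2 add: power_strict_mono)
  moreover have "?I = ennreal (enn2real ?I)"
    using W2_cost_finite[OF assms(1,2)] by simp
  ultimately have "?I < ennreal (c\<^sup>2)"
    by (metis enn2real_nonneg ennreal_less_iff)
  then show thesis
    using that by (auto simp: INF_less_iff intro: less_imp_le)
qed

lemma W2_le:
  fixes X Y :: "'b \<Rightarrow> 'a::euclidean_space"
  assumes "prob_space M" "X \<in> borel_measurable M" "Y \<in> borel_measurable M"
    and "(\<integral>\<^sup>+\<omega>. ennreal ((dist (X \<omega>) (Y \<omega>))\<^sup>2) \<partial>M) \<le> ennreal (c\<^sup>2)" and "0 \<le> c"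
  shows "W2 (distr M borel X) (distr M borel Y) \<le> c"
proof (rule power2_le_imp_le)
  show "(W2 (distr M borel X) (distr M borel Y))\<^sup>2 \<le> c\<^sup>2"
    using order_trans[OF W2_power2_le[OF assms(1-3)] assms(4)] by simp
qed fact

lemma couplingsD:
  assumes "\<pi> \<in> couplings \<mu> \<nu>"
  shows "prob_space \<pi>" "sets \<pi> = sets borel" "\<mu> = distr \<pi> borel fst" "\<nu> = distr \<pi> borel snd"
    "fst \<in> borel_measurable \<pi>" "snd \<in> borel_measurable \<pi>"
  using assms by (auto simp: couplings_def cong: measurable_cong_sets)

text \<open>The two coordinates of a nearly optimal plan, read in reverse order, compete in the
  reversed problem at the same cost.\<close>

lemma W2_commute_le:
  fixes \<mu> \<nu> :: "'a::euclidean_space measure"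
  assumes "\<mu> \<in> P2" "\<nu> \<in> P2"
  shows "W2 \<nu> \<mu> \<le> W2 \<mu> \<nu>"
proof (rule field_le_epsilon)
  fix e :: real assume "0 < e"
  then obtain \<pi> where \<pi>: "\<pi> \<in> couplings \<mu> \<nu>" "transport_cost \<pi> \<le> ennreal ((W2 \<mu> \<nu> + e)\<^sup>2)"
    using W2_coupling[OF assms, of "W2 \<mu> \<nu> + e"] by auto
  show "W2 \<nu> \<mu> \<le> W2 \<mu> \<nu> + e"
    using W2_le[OF couplingsD(1,6,5)[OF \<pi>(1)], of "W2 \<mu> \<nu> + e"] \<pi>(2) \<open>0 < e\<close> W2_nonneg[of \<mu> \<nu>]
    by (simp add: transport_cost_def dist_commute flip: couplingsD(3,4)[OF \<pi>(1)])
qed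

lemma W2_commute:
  assumes "\<mu> \<in> P2" "\<nu> \<in> P2"
  shows "W2 \<nu> \<mu> = W2 \<mu> \<nu>"
  using W2_commute_le assms by (intro antisym) auto

lemma distr_in_P2:
  fixes X :: "'b \<Rightarrow> 'a::euclidean_space"
  assumes "prob_space M" and [measurable]: "X \<in> borel_measurable M"
    and "(\<integral>\<^sup>+\<omega>. ennreal ((norm (X \<omega>))\<^sup>2) \<partial>M) < \<infinity>"
  shows "distr M borel X \<in> P2"
  using assms(3) prob_space.prob_space_distr[OF assms(1,2)]
  by (simp add: P2_def integrable_iff_bounded nn_integral_distr)

section \<open>The triangle inequality for mean square distances\<close>

text \<open>Young's inequality for the mixed term. The right side is linear in the squared
  distances, hence can be integrated, and it equals \<open>(a + b)\<^sup>2\<close> when the two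
  distances are \<open>a\<close> and \<open>b\<close>.\<close>

lemma dist_power2_le_weighted:
  fixes x y z :: "'a::metric_space"
  assumes "0 < a" "0 < b"
  shows "(dist x z)\<^sup>2 \<le> (1 + b / a) * (dist x y)\<^sup>2 + (1 + a / b) * (dist y z)\<^sup>2"
proof -
  let ?u = "dist x y" and ?v = "dist y z"
  have "(dist x z)\<^sup>2 \<le> (?u + ?v)\<^sup>2"
    by (intro power_mono dist_triangle) simp
  also have "\<dots> = ?u\<^sup>2 + ?v\<^sup>2 + 2 * ?u * ?v"
    by (simp add: power2_sum)
  also have "2 * ?u * ?v \<le> (b / a) * ?u\<^sup>2 + (a / b) * ?v\<^sup>2"
  proof -
    have "0 \<le> (b * ?u - a * ?v)\<^sup>2 / (a * b)" using assms by simp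
    also have "\<dots> = (b / a) * ?u\<^sup>2 + (a / b) * ?v\<^sup>2 - 2 * ?u * ?v"
      using assms by (simp add: field_simps power2_eq_square)
    finally show ?thesis by simp
  qed
  finally show ?thesis by (simp add: algebra_simps)
qed

lemma ennreal_le_power2_epsilon:
  assumes "\<And>e. 0 < e \<Longrightarrow> x \<le> ennreal ((b + e)\<^sup>2)"
  shows "x \<le> ennreal (b\<^sup>2)"
proof (rule tendsto_lowerbound)
  show "((\<lambda>e. ennreal ((b + e)\<^sup>2)) \<longlongrightarrow> ennreal (b\<^sup>2)) (at_right 0)"
    by (intro tendsto_ennrealI) (auto intro!: tendsto_eq_intros)
  show "\<forall>\<^sub>F e in at_right 0. x \<le> ennreal ((b + e)\<^sup>2)"
    using assms by (auto simp: eventually_at_right_less eventually_at_filter)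
qed simp

text \<open>Minkowski's inequality in the square mean, from integrating the weighted inequality with
  weights matched to the two bounds.\<close>

lemma nn_integral_dist_triangle:
  fixes X Y Z :: "'b \<Rightarrow> 'a::euclidean_space"
  assumes [measurable]: "X \<in> borel_measurable M" "Y \<in> borel_measurable M" "Z \<in> borel_measurable M"
    and XY: "(\<integral>\<^sup>+\<omega>. ennreal ((dist (X \<omega>) (Y \<omega>))\<^sup>2) \<partial>M) \<le> ennreal (a\<^sup>2)" and "0 \<le> a"
    and YZ: "(\<integral>\<^sup>+\<omega>. ennreal ((dist (Y \<omega>) (Z \<omega>))\<^sup>2) \<partial>M) \<le> ennreal (b\<^sup>2)" and "0 \<le> b"
  shows "(\<integral>\<^sup>+\<omega>. ennreal ((dist (X \<omega>) (Z \<omega>))\<^sup>2) \<partial>M) \<le> ennreal ((a + b)\<^sup>2)"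
proof (rule ennreal_le_power2_epsilon)
  fix e :: real assume "0 < e"
  \<comment> \<open>The weights are quotients of the bounds, so both bounds are first made
    positive.\<close>
  define a' b' where "a' = a + e/2" and "b' = b + e/2"
  have ab: "0 < a'" "0 < b'" "a \<le> a'" "b \<le> b'"
    using \<open>0 < e\<close> \<open>0 \<le> a\<close> \<open>0 \<le> b\<close> by (auto simp: a'_def b'_def)
  let ?XY = "\<lambda>\<omega>. ennreal ((dist (X \<omega>) (Y \<omega>))\<^sup>2)" and ?YZ = "\<lambda>\<omega>. ennreal ((dist (Y \<omega>) (Z \<omega>))\<^sup>2)"
  have "(\<integral>\<^sup>+\<omega>. ennreal ((dist (X \<omega>) (Z \<omega>))\<^sup>2) \<partial>M)
      \<le> (\<integral>\<^sup>+\<omega>. ennreal (1 + b' / a') * ?XY \<omega> + ennreal (1 + a' / b') * ?YZ \<omega> \<partial>M)"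
    using dist_power2_le_weighted[OF ab(1,2)] ab(1,2)
    by (intro nn_integral_mono) (simp flip: ennreal_mult ennreal_plus)
  also have "\<dots> = ennreal (1 + b' / a') * (\<integral>\<^sup>+\<omega>. ?XY \<omega> \<partial>M) + ennreal (1 + a' / b') * (\<integral>\<^sup>+\<omega>. ?YZ \<omega> \<partial>M)"
    by (simp add: nn_integral_add nn_integral_cmult)
  also have "\<dots> \<le> ennreal (1 + b' / a') * ennreal (a'\<^sup>2) + ennreal (1 + a' / b') * ennreal (b'\<^sup>2)"
    using ab \<open>0 \<le> a\<close> \<open>0 \<le> b\<close>
    by (intro add_mono mult_left_mono order_trans[OF XY] order_trans[OF YZ] ennreal_leI power_mono) auto
  also have "\<dots> = ennreal ((1 + b' / a') * a'\<^sup>2 + (1 + a' / b') * b'\<^sup>2)"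
    using ab(1,2) by (simp flip: ennreal_mult ennreal_plus)
  also have "(1 + b' / a') * a'\<^sup>2 + (1 + a' / b') * b'\<^sup>2 = (a + b + e)\<^sup>2"
  proof -
    have "(1 + b' / a') * a'\<^sup>2 + (1 + a' / b') * b'\<^sup>2 = (a' + b')\<^sup>2"
      using ab(1,2) by (simp add: field_simps power2_eq_square)
    then show ?thesis by (simp add: a'_def b'_def algebra_simps)
  qed
  finally show "(\<integral>\<^sup>+\<omega>. ennreal ((dist (X \<omega>) (Z \<omega>))\<^sup>2) \<partial>M) \<le> ennreal ((a + b + e)\<^sup>2)" .
qed

section \<open>Nearly optimal Markov kernels\<close>

text \<open>Each point is labelled by the first member of a dense sequence within distance
  \<open>\<delta>/2\<close>; two points with the same label are then within \<open>\<delta>\<close>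
  of each other. Countably many labels allow elementary conditioning.\<close>

lemma countable_partition_dist:
  fixes \<delta> :: real
  assumes "0 < \<delta>"
  obtains c :: "'a::euclidean_space \<Rightarrow> nat"
  where "c \<in> borel \<rightarrow>\<^sub>M count_space UNIV" "\<And>x y. c x = c y \<Longrightarrow> dist x y \<le> \<delta>"
proof -
  obtain D :: "'a set" where D: "countable D" "\<And>X. open X \<Longrightarrow> X \<noteq> {} \<Longrightarrow> \<exists>d\<in>D. d \<in> X"
    using countable_dense_exists by blast
  have "D \<noteq> {}" using D(2)[of UNIV] by auto
  define d where "d = from_nat_into D"
  have ex: "\<exists>i. dist x (d i) < \<delta>/2" for x
  proof -
    obtain y where "y \<in> D" "y \<in> ball x (\<delta>/2)" using D(2)[of "ball x (\<delta>/2)"] assms by auto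
    then show ?thesis
      using from_nat_into_surj[OF D(1)] by (auto simp: d_def)
  qed
  define c where "c x = (LEAST i. dist x (d i) < \<delta>/2)" for x
  have 1: "dist x (d (c x)) < \<delta>/2" for x
    unfolding c_def using ex by (rule LeastI_ex)
  show thesis
  proof
    show "c \<in> borel \<rightarrow>\<^sub>M count_space UNIV"
      unfolding c_def by measurable
    show "dist x y \<le> \<delta>" if "c x = c y" for x y
      using 1[of x] 1[of y] that dist_triangle2[of x y "d (c x)"] by simp
  qed
qed

text \<open>The law of total expectation over the cells of \<open>c\<close>, with \<open>h k\<close>
  as the conditional mean of \<open>\<psi>\<close>. The hypothesis on \<open>h\<close> is stated
  without division so that null cells and infinite values are covered.\<close>

lemma nn_integral_conditional:
  fixes c :: "'b \<Rightarrow> nat"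
  assumes [measurable]: "c \<in> M \<rightarrow>\<^sub>M count_space UNIV" "\<psi> \<in> borel_measurable M"
    and h: "\<And>k. h k * emeasure M {\<omega>\<in>space M. c \<omega> = k}
      = (\<integral>\<^sup>+\<omega>. \<psi> \<omega> * indicator {\<omega>\<in>space M. c \<omega> = k} \<omega> \<partial>M)"
  shows "(\<integral>\<^sup>+\<omega>. h (c \<omega>) \<partial>M) = (\<integral>\<^sup>+\<omega>. \<psi> \<omega> \<partial>M)"
proof -
  define C where "C k = {\<omega>\<in>space M. c \<omega> = k}" for k
  have C [measurable]: "C k \<in> sets M" for k
    unfolding C_def by measurable
  have split: "g (c \<omega>) \<omega> = (\<Sum>k. g k \<omega> * indicator (C k) \<omega>)" if "\<omega> \<in> space M"
    for g :: "nat \<Rightarrow> 'b \<Rightarrow> ennreal" and \<omega>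
    using that by (intro suminf_cmult_indicator[symmetric]) (auto simp: C_def disjoint_family_on_def)
  have "(\<integral>\<^sup>+\<omega>. h (c \<omega>) \<partial>M) = (\<integral>\<^sup>+\<omega>. (\<Sum>k. h k * indicator (C k) \<omega>) \<partial>M)"
    using split[of _ "\<lambda>k _. h k"] by (intro nn_integral_cong) simp
  also have "\<dots> = (\<Sum>k. h k * emeasure M (C k))"
    by (simp add: nn_integral_suminf nn_integral_cmult_indicator)
  also have "\<dots> = (\<Sum>k. \<integral>\<^sup>+\<omega>. \<psi> \<omega> * indicator (C k) \<omega> \<partial>M)"
    using h by (simp add: C_def)
  also have "\<dots> = (\<integral>\<^sup>+\<omega>. (\<Sum>k. \<psi> \<omega> * indicator (C k) \<omega>) \<partial>M)"
    by (rule nn_integral_suminf[symmetric]) measurable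
  also have "\<dots> = (\<integral>\<^sup>+\<omega>. \<psi> \<omega> \<partial>M)"
    using split[of _ "\<lambda>_. \<psi>"] by (intro nn_integral_cong) simp
  finally show ?thesis .
qed

lemma borel_measurable_kernel_dist [measurable]:
  fixes K :: "'a::euclidean_space \<Rightarrow> 'a measure"
  assumes [measurable]: "K \<in> borel \<rightarrow>\<^sub>M subprob_algebra borel"
  shows "(\<lambda>x. \<integral>\<^sup>+y. ennreal ((dist x y)\<^sup>2) \<partial>K x) \<in> borel_measurable borel"
  by (rule nn_integral_measurable_subprob_algebra2[where N=borel]) auto

text \<open>
  The kernel conditions a nearly optimal plan on the cell of a fine countable partition that contains
  the first coordinate and returns the second one. Averaged over the cells this recovers the second
  marginal, and the resampled first coordinate is within the mesh size of the original one.
\<close>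

lemma near_optimal_kernel:
  fixes \<mu> \<nu> :: "'a::euclidean_space measure"
  assumes \<mu>: "\<mu> \<in> P2" and \<nu>: "\<nu> \<in> P2" and "0 < \<epsilon>"
  obtains K :: "'a \<Rightarrow> 'a measure"
  where "K \<in> borel \<rightarrow>\<^sub>M subprob_algebra borel" "\<And>x. prob_space (K x)" "\<mu> \<bind> K = \<nu>"
    "(\<integral>\<^sup>+x. \<integral>\<^sup>+y. ennreal ((dist x y)\<^sup>2) \<partial>K x \<partial>\<mu>) \<le> ennreal ((W2 \<mu> \<nu> + \<epsilon>)\<^sup>2)"
proof -
  \<comment> \<open>The tolerance is split evenly between the mesh size \<open>\<delta>\<close> and
    the slack of the plan; the final bound is \<open>\<delta> + a\<close>.\<close>
  define \<delta> a where "\<delta> = \<epsilon> / 2" and "a = W2 \<mu> \<nu> + \<epsilon> / 2"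
  have pos: "0 < \<delta>" "0 < a" and "W2 \<mu> \<nu> < a"
    using \<open>0 < \<epsilon>\<close> W2_nonneg[of \<mu> \<nu>] by (auto simp: \<delta>_def a_def)
  obtain \<pi> where \<pi>: "\<pi> \<in> couplings \<mu> \<nu>" and cost: "transport_cost \<pi> \<le> ennreal (a\<^sup>2)"
    using W2_coupling[OF \<mu> \<nu> \<open>W2 \<mu> \<nu> < a\<close>] .
  obtain c :: "'a \<Rightarrow> nat" where c [measurable]: "c \<in> borel \<rightarrow>\<^sub>M count_space UNIV"
    and c_dist: "\<And>x y. c x = c y \<Longrightarrow> dist x y \<le> \<delta>"
    using countable_partition_dist[OF pos(1)] by blast
  interpret \<pi>: prob_space \<pi> by (rule couplingsD[OF \<pi>])
  note [measurable_cong] = couplingsD(2)[OF \<pi>] P2D(2)[OF \<mu>] P2D(2)[OF \<nu>]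
  define C where "C k = {z\<in>space \<pi>. c (fst z) = k}" for k
  have C [measurable]: "C k \<in> sets \<pi>" for k
    unfolding C_def by measurable
  \<comment> \<open>Conditioning on a null cell is undefined; the default \<open>\<nu>\<close> keeps
    every \<open>\<kappa> k\<close> a probability measure on the Borel sets.\<close>
  define \<kappa> where "\<kappa> k = (if emeasure \<pi> (C k) = 0 then \<nu> else distr (uniform_measure \<pi> (C k)) borel snd)" for k
  have prob_\<kappa>: "prob_space (\<kappa> k)" for k
    using P2D(1)[OF \<nu>]
    by (auto simp: \<kappa>_def intro!: prob_space.prob_space_distr prob_space_uniform_measure)
  have sets_\<kappa>: "sets (\<kappa> k) = sets borel" for k
    using P2D(2)[OF \<nu>] by (auto simp: \<kappa>_def)
  have \<kappa>_space: "\<kappa> k \<in> space (subprob_algebra borel)" for k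
    using prob_\<kappa> sets_\<kappa> by (simp add: space_subprob_algebra prob_space_imp_subprob_space)
  have [measurable]: "\<kappa> \<in> count_space UNIV \<rightarrow>\<^sub>M subprob_algebra borel"
    using \<kappa>_space by auto
  have [measurable]: "(\<lambda>x. \<kappa> (c x)) \<in> borel \<rightarrow>\<^sub>M subprob_algebra borel"
    by measurable
  have mu: "\<mu> = distr \<pi> borel fst" and nu: "\<nu> = distr \<pi> borel snd"
    using couplingsD[OF \<pi>] by auto
  have cond: "(\<integral>\<^sup>+z. g z \<partial>uniform_measure \<pi> (C k)) * emeasure \<pi> (C k) = (\<integral>\<^sup>+z. g z * indicator (C k) z \<partial>\<pi>)"
    if [measurable]: "g \<in> borel_measurable \<pi>" and "emeasure \<pi> (C k) \<noteq> 0" for g k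
    using that by (simp add: nn_integral_uniform_measure ennreal_divide_times less_top[symmetric])
  have null: "(\<integral>\<^sup>+z. g z * indicator (C k) z \<partial>\<pi>) = 0" if "emeasure \<pi> (C k) = 0" for g k
    using that by (intro nn_integral_null_set) auto
  show thesis
  proof
    show "(\<lambda>x. \<kappa> (c x)) \<in> borel \<rightarrow>\<^sub>M subprob_algebra borel" by measurable
    show "prob_space (\<kappa> (c x))" for x by (rule prob_\<kappa>)
    show "\<mu> \<bind> (\<lambda>x. \<kappa> (c x)) = \<nu>"
    proof (rule measure_eqI)
      show "sets (\<mu> \<bind> (\<lambda>x. \<kappa> (c x))) = sets \<nu>"
        using P2D[OF \<mu>] P2D[OF \<nu>] by (subst sets_bind[of _ _ borel]) (auto simp: sets_\<kappa>)
      fix A assume "A \<in> sets (\<mu> \<bind> (\<lambda>x. \<kappa> (c x)))"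
      then have A [measurable]: "A \<in> sets borel"
        using P2D[OF \<mu>] by (subst (asm) sets_bind[of _ _ borel]) (auto simp: sets_\<kappa>)
      have "emeasure (\<mu> \<bind> (\<lambda>x. \<kappa> (c x))) A = (\<integral>\<^sup>+x. emeasure (\<kappa> (c x)) A \<partial>\<mu>)"
        using P2D[OF \<mu>] by (intro emeasure_bind[where N=borel]) auto
      also have "\<dots> = (\<integral>\<^sup>+z. emeasure (\<kappa> (c (fst z))) A \<partial>\<pi>)"
        unfolding mu by (subst nn_integral_distr) auto
      also have "\<dots> = (\<integral>\<^sup>+z. indicator A (snd z) \<partial>\<pi>)"
      proof (rule nn_integral_conditional)
        fix k
        have "emeasure (\<kappa> k) A * emeasure \<pi> (C k) = (\<integral>\<^sup>+z. indicator A (snd z) * indicator (C k) z \<partial>\<pi>)"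
        proof (cases "emeasure \<pi> (C k) = 0")
          case False
          then have "emeasure (\<kappa> k) A = (\<integral>\<^sup>+z. indicator A (snd z) \<partial>uniform_measure \<pi> (C k))"
            by (subst nn_integral_indicator[symmetric])
              (auto simp: \<kappa>_def nn_integral_distr simp del: nn_integral_indicator)
          then show ?thesis using cond[OF _ False] by simp
        qed (simp add: null)
        then show "emeasure (\<kappa> k) A * emeasure \<pi> {z\<in>space \<pi>. c (fst z) = k}
          = (\<integral>\<^sup>+z. indicator A (snd z) * indicator {z\<in>space \<pi>. c (fst z) = k} z \<partial>\<pi>)"
          by (simp add: C_def)
      qed measurable
      also have "\<dots> = emeasure \<nu> A"
        unfolding nu by (subst nn_integral_indicator[symmetric]) (simp_all add: nn_integral_distr del: nn_integral_indicator)
      finally show "emeasure (\<mu> \<bind> (\<lambda>x. \<kappa> (c x))) A = emeasure \<nu> A" .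
    qed
    \<comment> \<open>The weighted triangle inequality through the resampled first coordinate, whose
      distance to the original one is replaced by the mesh size.\<close>
    define \<psi> where "\<psi> z = ennreal ((1 + a / \<delta>) * \<delta>\<^sup>2) + ennreal (1 + \<delta> / a) * ennreal ((dist (fst z) (snd z))\<^sup>2)"
      for z :: "'a \<times> 'a"
    have [measurable]: "\<psi> \<in> borel_measurable borel"
      unfolding \<psi>_def by measurable
    \<comment> \<open>The value infinity makes the pointwise bound trivial on null cells and adds
      nothing to the integral, since infinity times 0 is 0.\<close>
    define h where "h k = (if emeasure \<pi> (C k) = 0 then \<infinity> else \<integral>\<^sup>+z. \<psi> z \<partial>uniform_measure \<pi> (C k))" for k
    have "(\<integral>\<^sup>+x. \<integral>\<^sup>+y. ennreal ((dist x y)\<^sup>2) \<partial>\<kappa> (c x) \<partial>\<mu>)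
        = (\<integral>\<^sup>+z. \<integral>\<^sup>+y. ennreal ((dist (fst z) y)\<^sup>2) \<partial>\<kappa> (c (fst z)) \<partial>\<pi>)"
      unfolding mu by (subst nn_integral_distr) auto
    also have "\<dots> \<le> (\<integral>\<^sup>+z. h (c (fst z)) \<partial>\<pi>)"
    proof (rule nn_integral_mono)
      fix z
      show "(\<integral>\<^sup>+y. ennreal ((dist (fst z) y)\<^sup>2) \<partial>\<kappa> (c (fst z))) \<le> h (c (fst z))"
      proof (cases "emeasure \<pi> (C (c (fst z))) = 0")
        case False
        \<comment> \<open>A resampled pair lies almost surely in the cell of \<open>z\<close>, so
          its first coordinate is within \<open>\<delta>\<close> of that of
          \<open>z\<close>.\<close>
        have "AE z' in uniform_measure \<pi> (C (c (fst z))). z' \<in> C (c (fst z))"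
          by (rule AE_uniform_measureI) auto
        then have "AE z' in uniform_measure \<pi> (C (c (fst z))). ennreal ((dist (fst z) (snd z'))\<^sup>2) \<le> \<psi> z'"
        proof eventually_elim
          case (elim z')
          then have "dist (fst z) (fst z') \<le> \<delta>" by (intro c_dist) (simp add: C_def)
          have "(dist (fst z) (snd z'))\<^sup>2
              \<le> (1 + a / \<delta>) * (dist (fst z) (fst z'))\<^sup>2 + (1 + \<delta> / a) * (dist (fst z') (snd z'))\<^sup>2"
            by (rule dist_power2_le_weighted[OF pos])
          also have "\<dots> \<le> (1 + a / \<delta>) * \<delta>\<^sup>2 + (1 + \<delta> / a) * (dist (fst z') (snd z'))\<^sup>2"
            using pos \<open>dist (fst z) (fst z') \<le> \<delta>\<close> by (intro add_mono mult_left_mono power_mono) auto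
          finally show ?case
            using pos by (simp add: \<psi>_def flip: ennreal_mult ennreal_plus)
        qed
        then show ?thesis
          using False by (auto simp: \<kappa>_def h_def nn_integral_distr intro!: nn_integral_mono_AE)
      qed (simp add: h_def)
    qed
    also have "\<dots> = (\<integral>\<^sup>+z. \<psi> z \<partial>\<pi>)"
    proof (rule nn_integral_conditional)
      show "h k * emeasure \<pi> {z\<in>space \<pi>. c (fst z) = k}
          = (\<integral>\<^sup>+z. \<psi> z * indicator {z\<in>space \<pi>. c (fst z) = k} z \<partial>\<pi>)" for k
        using cond[of \<psi> k] null[of k \<psi>] by (simp add: h_def flip: C_def)
    qed measurable
    also have "\<dots> = ennreal ((1 + a / \<delta>) * \<delta>\<^sup>2) + ennreal (1 + \<delta> / a) * transport_cost \<pi>"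
      by (simp add: \<psi>_def transport_cost_def nn_integral_add nn_integral_cmult \<pi>.emeasure_space_1)
    also have "\<dots> \<le> ennreal ((1 + a / \<delta>) * \<delta>\<^sup>2) + ennreal (1 + \<delta> / a) * ennreal (a\<^sup>2)"
      using cost by (intro add_left_mono mult_left_mono) auto
    also have "\<dots> = ennreal ((1 + a / \<delta>) * \<delta>\<^sup>2 + (1 + \<delta> / a) * a\<^sup>2)"
      using pos by (simp flip: ennreal_mult ennreal_plus)
    also have "(1 + a / \<delta>) * \<delta>\<^sup>2 + (1 + \<delta> / a) * a\<^sup>2 = (\<delta> + a)\<^sup>2"
      using pos by (simp add: field_simps power2_eq_square)
    also have "\<delta> + a = W2 \<mu> \<nu> + \<epsilon>"
      by (simp add: \<delta>_def a_def)
    finally show "(\<integral>\<^sup>+x. \<integral>\<^sup>+y. ennreal ((dist x y)\<^sup>2) \<partial>\<kappa> (c x) \<partial>\<mu>) \<le> ennreal ((W2 \<mu> \<nu> + \<epsilon>)\<^sup>2)" .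
  qed
qed

section \<open>Gluing of plans and the triangle inequality\<close>

text \<open>Given \<open>\<omega>\<close>, the new coordinate is drawn from the kernel at
  \<open>f \<omega>\<close>. This takes the place of the gluing lemma: a space that already carries
  several variables gains one more, nearly optimally coupled to a chosen one, and the step can be
  iterated.\<close>

lemma near_optimal_extension:
  fixes f :: "'b \<Rightarrow> 'a::euclidean_space"
  assumes M: "prob_space M" and f [measurable]: "f \<in> borel_measurable M"
    and \<mu>: "distr M borel f \<in> P2" and \<nu>: "\<nu> \<in> P2" and "0 < \<epsilon>"
  obtains N :: "('b \<times> 'a) measure"
  where "prob_space N" "fst \<in> N \<rightarrow>\<^sub>M M" "snd \<in> borel_measurable N" "distr N M fst = M" "distr N borel snd = \<nu>"
    "(\<integral>\<^sup>+z. ennreal ((dist (f (fst z)) (snd z))\<^sup>2) \<partial>N) \<le> ennreal ((W2 (distr M borel f) \<nu> + \<epsilon>)\<^sup>2)"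
proof -
  interpret prob_space M by fact
  obtain K where K [measurable]: "K \<in> borel \<rightarrow>\<^sub>M subprob_algebra borel" and prob_K: "\<And>x. prob_space (K x)"
    and bind_K: "distr M borel f \<bind> K = \<nu>"
    and cost: "(\<integral>\<^sup>+x. \<integral>\<^sup>+y. ennreal ((dist x y)\<^sup>2) \<partial>K x \<partial>distr M borel f) \<le> ennreal ((W2 (distr M borel f) \<nu> + \<epsilon>)\<^sup>2)"
    using near_optimal_kernel[OF \<mu> \<nu> \<open>0 < \<epsilon>\<close>] by blast
  define L where "L \<omega> = distr (K (f \<omega>)) (M \<Otimes>\<^sub>M borel) (Pair \<omega>)" for \<omega>
  define N where "N = M \<bind> L"
  have sets_K [measurable_cong]: "sets (K x) = sets borel" for x
    using subprob_measurableD(2)[OF K, of x] by simp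
  have L [measurable]: "L \<in> M \<rightarrow>\<^sub>M subprob_algebra (M \<Otimes>\<^sub>M borel)"
    unfolding L_def by (rule measurable_distr2[where M=borel]) auto
  have prob_L: "prob_space (L \<omega>)" if "\<omega> \<in> space M" for \<omega>
    using that prob_K unfolding L_def by (intro prob_space.prob_space_distr) auto
  have sets_N [measurable_cong]: "sets N = sets (M \<Otimes>\<^sub>M borel)"
    unfolding N_def using not_empty by (intro sets_bind) (auto simp: L_def)
  have int_N: "(\<integral>\<^sup>+z. g z \<partial>N) = (\<integral>\<^sup>+\<omega>. \<integral>\<^sup>+y. g (\<omega>, y) \<partial>K (f \<omega>) \<partial>M)"
    if [measurable]: "g \<in> borel_measurable (M \<Otimes>\<^sub>M borel)" for g
    unfolding N_def by (subst nn_integral_bind[OF _ L])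
      (auto simp: L_def nn_integral_distr intro!: nn_integral_cong)
  show thesis
  proof
    show "prob_space N"
      unfolding N_def using prob_L by (intro prob_space_bind[OF _ L]) auto
    show "fst \<in> N \<rightarrow>\<^sub>M M" "snd \<in> borel_measurable N" by measurable
    show "distr N M fst = M"
    proof (rule measure_eqI)
      fix A assume "A \<in> sets (distr N M fst)"
      then have [measurable]: "A \<in> sets M" by simp
      show "emeasure (distr N M fst) A = emeasure M A"
        by (subst nn_integral_indicator[symmetric])
          (auto simp: nn_integral_distr int_N prob_space.emeasure_space_1[OF prob_K] simp del: nn_integral_indicator,
           auto)
    qed simp
    show "distr N borel snd = \<nu>"
    proof (rule measure_eqI)
      fix A :: "'a set" assume "A \<in> sets (distr N borel snd)"
      then have [measurable]: "A \<in> sets borel" by simp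
      have "emeasure (distr N borel snd) A = (\<integral>\<^sup>+z. indicator A (snd z) \<partial>N)"
        by (subst nn_integral_indicator[symmetric]) (auto simp: nn_integral_distr simp del: nn_integral_indicator)
      also have "\<dots> = (\<integral>\<^sup>+\<omega>. emeasure (K (f \<omega>)) A \<partial>M)"
        by (simp add: int_N)
      also have "\<dots> = emeasure (distr M borel f \<bind> K) A"
        by (subst emeasure_bind[where N=borel]) (auto simp: nn_integral_distr)
      finally show "emeasure (distr N borel snd) A = emeasure \<nu> A" by (simp add: bind_K)
    qed (simp add: P2D(2)[OF \<nu>])
    show "(\<integral>\<^sup>+z. ennreal ((dist (f (fst z)) (snd z))\<^sup>2) \<partial>N) \<le> ennreal ((W2 (distr M borel f) \<nu> + \<epsilon>)\<^sup>2)"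
      using cost by (subst (asm) nn_integral_distr) (auto simp: int_N)
  qed
qed

text \<open>With the next lemma: variables of the original space keep their laws and integrals when
  they are read on an extension of it.\<close>

lemma distr_eq_fst:
  assumes "fst \<in> N \<rightarrow>\<^sub>M M" "distr N M fst = M" "g \<in> M \<rightarrow>\<^sub>M L"
  shows "distr N L (\<lambda>z. g (fst z)) = distr M L g"
  using distr_distr[OF assms(3,1)] assms(2) by (simp add: o_def)

lemma nn_integral_eq_fst:
  assumes "fst \<in> N \<rightarrow>\<^sub>M M" "distr N M fst = M" "g \<in> borel_measurable M"
  shows "(\<integral>\<^sup>+z. g (fst z) \<partial>N) = (\<integral>\<^sup>+\<omega>. g \<omega> \<partial>M)"
  using nn_integral_distr[OF assms(1), of g] assms(2,3) by simp

text \<open>A nearly optimal plan of \<open>\<mu>\<close> and \<open>\<nu>\<close> is extended by a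
  coordinate of law \<open>\<rho>\<close> nearly optimal for its second coordinate; the outer two
  coordinates couple \<open>\<mu>\<close> and \<open>\<rho>\<close>.\<close>

lemma W2_triangle:
  fixes \<mu> \<nu> \<rho> :: "'a::euclidean_space measure"
  assumes \<mu>: "\<mu> \<in> P2" and \<nu>: "\<nu> \<in> P2" and \<rho>: "\<rho> \<in> P2"
  shows "W2 \<mu> \<rho> \<le> W2 \<mu> \<nu> + W2 \<nu> \<rho>"
proof (rule field_le_epsilon)
  fix e :: real assume "0 < e"
  obtain \<pi> where \<pi>: "\<pi> \<in> couplings \<mu> \<nu>" "transport_cost \<pi> \<le> ennreal ((W2 \<mu> \<nu> + e/2)\<^sup>2)"
    using W2_coupling[OF \<mu> \<nu>, of "W2 \<mu> \<nu> + e/2"] \<open>0 < e\<close> by auto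
  note C = couplingsD[OF \<pi>(1)]
  note C(5,6) [measurable]
  obtain N where N: "prob_space N" "fst \<in> N \<rightarrow>\<^sub>M \<pi>" "snd \<in> borel_measurable N"
      "distr N \<pi> fst = \<pi>" "distr N borel snd = \<rho>"
      "(\<integral>\<^sup>+z. ennreal ((dist (snd (fst z)) (snd z))\<^sup>2) \<partial>N) \<le> ennreal ((W2 \<nu> \<rho> + e/2)\<^sup>2)"
    using near_optimal_extension[OF C(1,6) _ \<rho>, of "e/2"] \<open>0 < e\<close> \<nu> C(4) by auto
  note N(2,3)[measurable]
  have "(\<integral>\<^sup>+z. ennreal ((dist (fst (fst z)) (snd (fst z)))\<^sup>2) \<partial>N) \<le> ennreal ((W2 \<mu> \<nu> + e/2)\<^sup>2)"
    using \<pi>(2) by (subst nn_integral_eq_fst[OF N(2,4)]) (auto simp: transport_cost_def)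
  then have "(\<integral>\<^sup>+z. ennreal ((dist (fst (fst z)) (snd z))\<^sup>2) \<partial>N)
      \<le> ennreal (((W2 \<mu> \<nu> + e/2) + (W2 \<nu> \<rho> + e/2))\<^sup>2)"
    using N(6) \<open>0 < e\<close> W2_nonneg[of \<mu> \<nu>] W2_nonneg[of \<nu> \<rho>]
    by (intro nn_integral_dist_triangle[where Y="\<lambda>z. snd (fst z)" and a="W2 \<mu> \<nu> + e/2" and b="W2 \<nu> \<rho> + e/2"]) auto
  then have "W2 (distr N borel (\<lambda>z. fst (fst z))) (distr N borel snd) \<le> (W2 \<mu> \<nu> + e/2) + (W2 \<nu> \<rho> + e/2)"
    using \<open>0 < e\<close> W2_nonneg[of \<mu> \<nu>] W2_nonneg[of \<nu> \<rho>] by (intro W2_le N(1)) auto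
  then show "W2 \<mu> \<rho> \<le> W2 \<mu> \<nu> + W2 \<nu> \<rho> + e"
    using distr_eq_fst[OF N(2,4) C(5)] C(3) N(5) by simp
qed

section \<open>Measures at distance zero coincide\<close>

text \<open>By Markov's inequality a plan of tiny cost moves almost no mass farther than
  \<open>\<delta>\<close>, so the mass of \<open>S\<close> stays in the
  \<open>\<delta>\<close>-neighbourhood \<open>T \<delta>\<close>; these neighbourhoods shrink to
  \<open>S\<close> because \<open>S\<close> is closed.\<close>

lemma W2_eq_0_closed_le:
  fixes \<mu> \<nu> :: "'a::euclidean_space measure"
  assumes \<mu>: "\<mu> \<in> P2" and \<nu>: "\<nu> \<in> P2" and "W2 \<mu> \<nu> = 0" and "closed S"
  shows "emeasure \<mu> S \<le> emeasure \<nu> S"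
proof (cases "S = {}")
  case False
  interpret \<nu>: prob_space \<nu> by (rule P2D[OF \<nu>])
  note [measurable_cong] = P2D(2)[OF \<mu>] P2D(2)[OF \<nu>]
  have [measurable]: "S \<in> sets borel" using \<open>closed S\<close> by simp
  define T where "T \<delta> = {y. infdist y S \<le> \<delta>}" for \<delta>
  have [measurable]: "T \<delta> \<in> sets borel" for \<delta>
    unfolding T_def by (intro borel_closed closed_Collect_le continuous_intros)
  have le: "emeasure \<mu> S \<le> emeasure \<nu> (T \<delta>)" if "0 < \<delta>" for \<delta>
  proof (rule ennreal_le_epsilon)
    fix e :: real assume "0 < e"
    \<comment> \<open>The bound is chosen so that the cost divided by
      \<open>\<delta>\<^sup>2\<close> is at most \<open>e\<close>.\<close>
    obtain \<pi> where \<pi>: "\<pi> \<in> couplings \<mu> \<nu>" "transport_cost \<pi> \<le> ennreal ((\<delta> * sqrt e)\<^sup>2)"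
      using W2_coupling[OF \<mu> \<nu>, of "\<delta> * sqrt e"] \<open>0 < e\<close> \<open>0 < \<delta>\<close> \<open>W2 \<mu> \<nu> = 0\<close> by auto
    note C = couplingsD[OF \<pi>(1)]
    note C(5,6) [measurable] and C(2) [measurable_cong]
    have "emeasure \<mu> S = (\<integral>\<^sup>+z. indicator S (fst z) \<partial>\<pi>)"
      unfolding C(3) by (subst nn_integral_indicator[symmetric]) (auto simp: nn_integral_distr simp del: nn_integral_indicator)
    also have "\<dots> \<le> (\<integral>\<^sup>+z. indicator (T \<delta>) (snd z) + ennreal (1 / \<delta>\<^sup>2) * ennreal ((dist (fst z) (snd z))\<^sup>2) \<partial>\<pi>)"
    proof (rule nn_integral_mono)
      fix z :: "'a \<times> 'a"
      show "indicator S (fst z) \<le> indicator (T \<delta>) (snd z) + ennreal (1 / \<delta>\<^sup>2) * ennreal ((dist (fst z) (snd z))\<^sup>2)"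
      proof (cases "fst z \<in> S \<and> snd z \<notin> T \<delta>")
        case True
        then have "\<delta> < dist (snd z) (fst z)"
          using infdist_le[of "fst z" S "snd z"] by (auto simp: T_def)
        then have "\<delta>\<^sup>2 \<le> (dist (fst z) (snd z))\<^sup>2"
          using \<open>0 < \<delta>\<close> by (intro power_mono) (auto simp: dist_commute)
        then have "ennreal 1 \<le> ennreal (1 / \<delta>\<^sup>2) * ennreal ((dist (fst z) (snd z))\<^sup>2)"
          using \<open>0 < \<delta>\<close> by (subst ennreal_mult[symmetric]) (auto intro!: ennreal_leI simp: field_simps)
        then show ?thesis using True by simp
      qed (auto simp: indicator_def)
    qed
    also have "\<dots> = emeasure \<nu> (T \<delta>) + ennreal (1 / \<delta>\<^sup>2) * transport_cost \<pi>"
      unfolding C(4) transport_cost_def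
      by (subst nn_integral_indicator[symmetric])
        (auto simp: nn_integral_add nn_integral_cmult nn_integral_distr simp del: nn_integral_indicator)
    also have "\<dots> \<le> emeasure \<nu> (T \<delta>) + ennreal (1 / \<delta>\<^sup>2) * ennreal ((\<delta> * sqrt e)\<^sup>2)"
      using \<pi>(2) by (intro add_left_mono mult_left_mono) auto
    also have "ennreal (1 / \<delta>\<^sup>2) * ennreal ((\<delta> * sqrt e)\<^sup>2) = ennreal e"
      using \<open>0 < e\<close> \<open>0 < \<delta>\<close> by (simp add: power_mult_distrib flip: ennreal_mult)
    finally show "emeasure \<mu> S \<le> emeasure \<nu> (T \<delta>) + ennreal e" .
  qed
  have "emeasure \<mu> S \<le> (INF n. emeasure \<nu> (T (1 / Suc n)))"
    by (intro INF_greatest le) auto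
  also have "\<dots> = emeasure \<nu> (\<Inter>n. T (1 / Suc n))"
  proof (rule INF_emeasure_decseq)
    have "infdist y S \<le> 1 / Suc m" if "infdist y S \<le> 1 / Suc n" "m \<le> n" for y m n
      using that by (elim order_trans) (simp add: frac_le)
    then show "decseq (\<lambda>n. T (1 / Suc n))"
      by (auto simp: decseq_def T_def)
  qed auto
  also have "(\<Inter>n. T (1 / Suc n)) = S"
  proof (intro equalityI subsetI)
    fix y assume y: "y \<in> (\<Inter>n. T (1 / Suc n))"
    have "infdist y S \<le> 0"
    proof (rule field_le_epsilon)
      fix e :: real assume "0 < e"
      then obtain n where "inverse (Suc n) < e" using reals_Archimedean by blast
      moreover have "infdist y S \<le> 1 / Suc n" using y by (auto simp: T_def)
      ultimately show "infdist y S \<le> 0 + e" by (simp add: inverse_eq_divide)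
    qed
    then show "y \<in> S"
      using infdist_nonneg[of y S] in_closed_iff_infdist_zero[OF \<open>closed S\<close> False] by simp
  qed (auto simp: T_def)
  finally show ?thesis .
qed simp

text \<open>Closed sets generate the Borel sets and are stable under intersection; by symmetry of
  \<open>W2\<close> the previous inequality holds in both directions on them.\<close>

lemma W2_eq_0_imp_eq:
  fixes \<mu> \<nu> :: "'a::euclidean_space measure"
  assumes \<mu>: "\<mu> \<in> P2" and \<nu>: "\<nu> \<in> P2" and W: "W2 \<mu> \<nu> = 0"
  shows "\<mu> = \<nu>"
proof (rule measure_eqI_generator_eq[where \<Omega>=UNIV and E="Collect closed" and A="\<lambda>_. UNIV"])
  show "emeasure \<mu> X = emeasure \<nu> X" if "X \<in> Collect closed" for X
    using that W2_eq_0_closed_le[OF \<mu> \<nu> W] W2_eq_0_closed_le[OF \<nu> \<mu>] W W2_commute[OF \<mu> \<nu>]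
    by (intro antisym) auto
  show "emeasure \<mu> UNIV \<noteq> \<infinity>"
    using prob_space.emeasure_space_1[OF P2D(1)[OF \<mu>]] P2D(3)[OF \<mu>] by simp
qed (auto simp: Int_stable_def P2D(2)[OF \<mu>] P2D(2)[OF \<nu>] borel_eq_closed sets_measure_of)

section \<open>Interpolation and convexity of the functional\<close>

text \<open>Expansion of inner products. Being an equality, it serves upper and lower bounds
  alike.\<close>

lemma dist_interpolation:
  fixes x0 x1 y :: "'a::real_inner"
  shows "(dist ((1 - t) *\<^sub>R x0 + t *\<^sub>R x1) y)\<^sup>2 + t * (1 - t) * (dist x0 x1)\<^sup>2
    = (1 - t) * (dist x0 y)\<^sup>2 + t * (dist x1 y)\<^sup>2"
  by (simp add: dist_norm power2_norm_eq_inner inner_diff_left inner_diff_right inner_add_left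
      inner_add_right inner_commute algebra_simps)

text \<open>Arranged with sums on both sides, so that no subtraction occurs in
  \<open>ennreal\<close> and infinite integrals are allowed.\<close>

lemma nn_integral_interpolation:
  fixes X0 X1 Y :: "'b \<Rightarrow> 'a::euclidean_space"
  assumes [measurable]: "X0 \<in> borel_measurable M" "X1 \<in> borel_measurable M" "Y \<in> borel_measurable M"
    and "0 \<le> t" "t \<le> 1"
  shows "(\<integral>\<^sup>+\<omega>. ennreal ((dist ((1 - t) *\<^sub>R X0 \<omega> + t *\<^sub>R X1 \<omega>) (Y \<omega>))\<^sup>2) \<partial>M)
      + ennreal (t * (1 - t)) * (\<integral>\<^sup>+\<omega>. ennreal ((dist (X0 \<omega>) (X1 \<omega>))\<^sup>2) \<partial>M)
    = ennreal (1 - t) * (\<integral>\<^sup>+\<omega>. ennreal ((dist (X0 \<omega>) (Y \<omega>))\<^sup>2) \<partial>M)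
      + ennreal t * (\<integral>\<^sup>+\<omega>. ennreal ((dist (X1 \<omega>) (Y \<omega>))\<^sup>2) \<partial>M)"
  (is "?A + ?B = ?C + ?D")
proof -
  have "?A + ?B = (\<integral>\<^sup>+\<omega>. ennreal ((dist ((1 - t) *\<^sub>R X0 \<omega> + t *\<^sub>R X1 \<omega>) (Y \<omega>))\<^sup>2)
      + ennreal (t * (1 - t)) * ennreal ((dist (X0 \<omega>) (X1 \<omega>))\<^sup>2) \<partial>M)"
    by (simp add: nn_integral_add nn_integral_cmult)
  also have "\<dots> = (\<integral>\<^sup>+\<omega>. ennreal (1 - t) * ennreal ((dist (X0 \<omega>) (Y \<omega>))\<^sup>2)
      + ennreal t * ennreal ((dist (X1 \<omega>) (Y \<omega>))\<^sup>2) \<partial>M)"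
    using assms(4,5) dist_interpolation[of t]
    by (intro nn_integral_cong) (simp flip: ennreal_mult ennreal_plus)
  also have "\<dots> = ?C + ?D"
    by (simp add: nn_integral_add nn_integral_cmult)
  finally show ?thesis .
qed

text \<open>\<open>X0\<close>, \<open>Y\<close>, \<open>X1\<close> are glued along \<open>Y\<close>
  of law \<open>\<mu>\<close>; \<open>\<rho>\<close> is the law of the interpolated variable and
  \<open>D\<close> the mean squared distance of \<open>X0\<close> and \<open>X1\<close>. Stating
  \<open>D\<close> rather than \<open>(W2 \<rho>0 \<rho>1)\<^sup>2\<close> lets the very same
  quantity occur in the upper bound for \<open>\<mu>\<close> and in the lower bounds for all
  \<open>\<nu>\<close>.\<close>

lemma W2_interpolation:
  fixes \<rho>0 \<rho>1 \<mu> :: "'a::euclidean_space measure"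
  assumes \<rho>0: "\<rho>0 \<in> P2" and \<rho>1: "\<rho>1 \<in> P2" and \<mu>: "\<mu> \<in> P2" and t: "0 \<le> t" "t \<le> 1" and "0 < \<epsilon>"
  obtains \<rho> D where "\<rho> \<in> P2" "(W2 \<rho>0 \<rho>1)\<^sup>2 \<le> D"
    "(W2 \<rho> \<mu>)\<^sup>2 + t * (1 - t) * D \<le> (1 - t) * (W2 \<rho>0 \<mu>)\<^sup>2 + t * (W2 \<rho>1 \<mu>)\<^sup>2 + \<epsilon>"
    "\<And>\<nu>. \<nu> \<in> P2 \<Longrightarrow> (1 - t) * (W2 \<rho>0 \<nu>)\<^sup>2 + t * (W2 \<rho>1 \<nu>)\<^sup>2 \<le> (W2 \<rho> \<nu>)\<^sup>2 + t * (1 - t) * D"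
proof -
  define a0 a1 where "a0 = W2 \<rho>0 \<mu>" and "a1 = W2 \<rho>1 \<mu>"
  have a: "0 \<le> a0" "0 \<le> a1" and a1: "W2 \<mu> \<rho>1 = a1"
    using W2_nonneg W2_commute[OF \<rho>1 \<mu>] by (auto simp: a0_def a1_def)
  \<comment> \<open>Small enough that enlarging \<open>a0\<close> or \<open>a1\<close> by
    \<open>e\<close> raises its square by at most \<open>\<epsilon>\<close>.\<close>
  define e where "e = min 1 (\<epsilon> / (2 * (a0 + a1) + 1))"
  have e: "0 < e" "e \<le> 1" "e * (2 * (a0 + a1) + 1) \<le> \<epsilon>"
    using \<open>0 < \<epsilon>\<close> a by (auto simp: e_def pos_le_divide_eq[symmetric])
  have sq: "(b + e)\<^sup>2 \<le> b\<^sup>2 + \<epsilon>" if "0 \<le> b" "b \<le> a0 + a1" for b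
  proof -
    have "(b + e)\<^sup>2 = b\<^sup>2 + e * (2 * b + e)" by (simp add: power2_eq_square algebra_simps)
    also have "e * (2 * b + e) \<le> e * (2 * (a0 + a1) + 1)"
      using that e by (intro mult_left_mono add_mono) auto
    finally show ?thesis using e(3) by simp
  qed
  obtain \<pi> where \<pi>: "\<pi> \<in> couplings \<rho>0 \<mu>" "transport_cost \<pi> \<le> ennreal ((a0 + e)\<^sup>2)"
    using W2_coupling[OF \<rho>0 \<mu>, of "a0 + e"] e by (auto simp: a0_def)
  note C = couplingsD[OF \<pi>(1)]
  note C(5,6) [measurable]
  obtain N where N: "prob_space N" "fst \<in> N \<rightarrow>\<^sub>M \<pi>" "snd \<in> borel_measurable N"
      "distr N \<pi> fst = \<pi>" "distr N borel snd = \<rho>1"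
      "(\<integral>\<^sup>+z. ennreal ((dist (snd (fst z)) (snd z))\<^sup>2) \<partial>N) \<le> ennreal ((a1 + e)\<^sup>2)"
    using near_optimal_extension[OF C(1,6) _ \<rho>1 e(1)] \<mu> by (auto simp: a1 simp flip: C(4))
  note N(2,3)[measurable]
  define X0 Y X1 X where "X0 z = fst (fst z)" and "Y z = snd (fst z)" and "X1 z = snd z"
    and "X z = (1 - t) *\<^sub>R X0 z + t *\<^sub>R X1 z" for z :: "('a \<times> 'a) \<times> 'a"
  have [measurable]: "X0 \<in> borel_measurable N" "Y \<in> borel_measurable N" "X1 \<in> borel_measurable N"
    unfolding X0_def Y_def X1_def by measurable
  have [measurable]: "X \<in> borel_measurable N"
    unfolding X_def by measurable
  have law: "distr N borel X0 = \<rho>0" "distr N borel Y = \<mu>" "distr N borel X1 = \<rho>1"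
    using distr_eq_fst[OF N(2,4) C(5)] distr_eq_fst[OF N(2,4) C(6)] C(3,4) N(5)
    by (simp_all add: X0_def[abs_def] Y_def[abs_def] X1_def[abs_def])
  have c0: "(\<integral>\<^sup>+z. ennreal ((dist (X0 z) (Y z))\<^sup>2) \<partial>N) \<le> ennreal ((a0 + e)\<^sup>2)"
    using \<pi>(2) unfolding X0_def Y_def
    by (subst nn_integral_eq_fst[OF N(2,4)]) (auto simp: transport_cost_def)
  have c1: "(\<integral>\<^sup>+z. ennreal ((dist (X1 z) (Y z))\<^sup>2) \<partial>N) \<le> ennreal ((a1 + e)\<^sup>2)"
    using N(6) unfolding X1_def Y_def by (simp add: dist_commute)
  define D where "D = enn2real (\<integral>\<^sup>+z. ennreal ((dist (X0 z) (X1 z))\<^sup>2) \<partial>N)"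
  have "0 \<le> D" by (simp add: D_def)
  \<comment> \<open>Finiteness of this integral makes \<open>D\<close> its true value, so that
    \<open>D\<close> may be moved across inequalities.\<close>
  have "(\<integral>\<^sup>+z. ennreal ((dist (X0 z) (X1 z))\<^sup>2) \<partial>N) \<le> ennreal ((a0 + e + (a1 + e))\<^sup>2)"
    using c1 a e by (intro nn_integral_dist_triangle[OF _ _ _ c0]) (auto simp: dist_commute)
  then have D: "(\<integral>\<^sup>+z. ennreal ((dist (X0 z) (X1 z))\<^sup>2) \<partial>N) = ennreal D"
    unfolding D_def by (intro ennreal_enn2real[symmetric] le_less_trans[OF _ ennreal_less_top])
  show thesis
  proof
    have fin: "(\<integral>\<^sup>+z. ennreal ((dist (Z z) 0)\<^sup>2) \<partial>N) < \<infinity>"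
      if [measurable]: "Z \<in> borel_measurable N" and "distr N borel Z \<in> P2" for Z :: "_ \<Rightarrow> 'a"
      using P2D(4)[OF that(2)] by (simp add: nn_integral_distr)
    have "(\<integral>\<^sup>+z. ennreal ((dist (X z) 0)\<^sup>2) \<partial>N)
        \<le> ennreal (1 - t) * (\<integral>\<^sup>+z. ennreal ((dist (X0 z) 0)\<^sup>2) \<partial>N)
          + ennreal t * (\<integral>\<^sup>+z. ennreal ((dist (X1 z) 0)\<^sup>2) \<partial>N)"
      unfolding X_def by (subst nn_integral_interpolation[symmetric]) (auto simp: t)
    also have "\<dots> < \<infinity>"
      using fin[of X0] fin[of X1] by (simp add: law \<rho>0 \<rho>1 ennreal_mult_less_top)
    finally show "distr N borel X \<in> P2"
      using N(1) by (intro distr_in_P2) auto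
    show "(W2 \<rho>0 \<rho>1)\<^sup>2 \<le> D"
      using W2_power2_le[OF N(1), of X0 X1] by (simp add: law D \<open>0 \<le> D\<close>)
    have "ennreal ((W2 (distr N borel X) \<mu>)\<^sup>2 + t * (1 - t) * D)
        = ennreal ((W2 (distr N borel X) (distr N borel Y))\<^sup>2) + ennreal (t * (1 - t)) * ennreal D"
      using t \<open>0 \<le> D\<close> by (simp add: law flip: ennreal_mult ennreal_plus)
    also have "\<dots> \<le> (\<integral>\<^sup>+z. ennreal ((dist (X z) (Y z))\<^sup>2) \<partial>N) + ennreal (t * (1 - t)) * ennreal D"
      using N(1) by (intro add_right_mono W2_power2_le) auto
    also have "\<dots> = ennreal (1 - t) * (\<integral>\<^sup>+z. ennreal ((dist (X0 z) (Y z))\<^sup>2) \<partial>N)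
          + ennreal t * (\<integral>\<^sup>+z. ennreal ((dist (X1 z) (Y z))\<^sup>2) \<partial>N)"
      unfolding X_def D[symmetric] using t by (intro nn_integral_interpolation) auto
    also have "\<dots> \<le> ennreal (1 - t) * ennreal (a0\<^sup>2 + \<epsilon>) + ennreal t * ennreal (a1\<^sup>2 + \<epsilon>)"
      using sq a by (intro add_mono mult_left_mono order_trans[OF c0] order_trans[OF c1] ennreal_leI) auto
    also have "\<dots> = ennreal ((1 - t) * (a0\<^sup>2 + \<epsilon>) + t * (a1\<^sup>2 + \<epsilon>))"
      using t \<open>0 < \<epsilon>\<close> by (simp flip: ennreal_mult ennreal_plus)
    also have "(1 - t) * (a0\<^sup>2 + \<epsilon>) + t * (a1\<^sup>2 + \<epsilon>) = (1 - t) * a0\<^sup>2 + t * a1\<^sup>2 + \<epsilon>"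
      by (simp add: algebra_simps)
    finally show "(W2 (distr N borel X) \<mu>)\<^sup>2 + t * (1 - t) * D
        \<le> (1 - t) * (W2 \<rho>0 \<mu>)\<^sup>2 + t * (W2 \<rho>1 \<mu>)\<^sup>2 + \<epsilon>"
      using t \<open>0 < \<epsilon>\<close> by (subst (asm) ennreal_le_iff) (auto simp: a0_def a1_def)
    fix \<nu> :: "'a measure" assume \<nu>: "\<nu> \<in> P2"
    let ?b = "W2 (distr N borel X) \<nu>" and ?L = "(1 - t) * (W2 \<rho>0 \<nu>)\<^sup>2 + t * (W2 \<rho>1 \<nu>)\<^sup>2"
    \<comment> \<open>For the lower bound \<open>N\<close> is extended by a coordinate of law
      \<open>\<nu>\<close> nearly optimal for \<open>X\<close>; paired with it, \<open>X0\<close>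
      and \<open>X1\<close> bound \<open>W2 \<rho>0 \<nu>\<close> and
      \<open>W2 \<rho>1 \<nu>\<close>. A negative left side becomes 0 in \<open>ennreal\<close>,
      which is harmless against a square.\<close>
    have "ennreal (?L - t * (1 - t) * D) \<le> ennreal (?b\<^sup>2)"
    proof (rule ennreal_le_power2_epsilon)
      fix e :: real assume "0 < e"
      obtain N' where N': "prob_space N'" "fst \<in> N' \<rightarrow>\<^sub>M N" "snd \<in> borel_measurable N'"
          "distr N' N fst = N" "distr N' borel snd = \<nu>"
          "(\<integral>\<^sup>+z. ennreal ((dist (X (fst z)) (snd z))\<^sup>2) \<partial>N') \<le> ennreal ((?b + e)\<^sup>2)"
        using near_optimal_extension[OF N(1) _ \<open>distr N borel X \<in> P2\<close> \<nu> \<open>0 < e\<close>] by auto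
      note N'(2,3)[measurable]
      have law': "distr N' borel (\<lambda>z. X0 (fst z)) = \<rho>0" "distr N' borel (\<lambda>z. X1 (fst z)) = \<rho>1"
        using distr_eq_fst[OF N'(2,4), of X0 borel] distr_eq_fst[OF N'(2,4), of X1 borel] by (simp_all add: law)
      have D': "(\<integral>\<^sup>+z. ennreal ((dist (X0 (fst z)) (X1 (fst z)))\<^sup>2) \<partial>N') = ennreal D"
        by (subst nn_integral_eq_fst[OF N'(2,4)]) (auto simp: D)
      have "ennreal ?L = ennreal (1 - t) * ennreal ((W2 \<rho>0 \<nu>)\<^sup>2) + ennreal t * ennreal ((W2 \<rho>1 \<nu>)\<^sup>2)"
        using t by (simp flip: ennreal_mult ennreal_plus)
      also have "\<dots> \<le> ennreal (1 - t) * (\<integral>\<^sup>+z. ennreal ((dist (X0 (fst z)) (snd z))\<^sup>2) \<partial>N')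
          + ennreal t * (\<integral>\<^sup>+z. ennreal ((dist (X1 (fst z)) (snd z))\<^sup>2) \<partial>N')"
        unfolding law'[symmetric] N'(5)[symmetric] using N'(1)
        by (intro add_mono mult_left_mono W2_power2_le) auto
      also have "\<dots> = (\<integral>\<^sup>+z. ennreal ((dist (X (fst z)) (snd z))\<^sup>2) \<partial>N') + ennreal (t * (1 - t)) * ennreal D"
        unfolding X_def D'[symmetric] using t by (intro nn_integral_interpolation[symmetric]) auto
      also have "\<dots> \<le> ennreal ((?b + e)\<^sup>2) + ennreal (t * (1 - t)) * ennreal D"
        by (intro add_right_mono N'(6))
      also have "\<dots> = ennreal ((?b + e)\<^sup>2 + t * (1 - t) * D)"
        using t \<open>0 \<le> D\<close> by (simp flip: ennreal_mult ennreal_plus)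
      finally have "?L \<le> (?b + e)\<^sup>2 + t * (1 - t) * D"
        using t \<open>0 \<le> D\<close> by (subst (asm) ennreal_le_iff) auto
      then show "ennreal (?L - t * (1 - t) * D) \<le> ennreal ((?b + e)\<^sup>2)"
        by (intro ennreal_leI) simp
    qed
    then show "?L \<le> ?b\<^sup>2 + t * (1 - t) * D"
      by (subst (asm) ennreal_le_iff) auto
  qed
qed

text \<open>Take \<alpha> times the upper bound at \<open>\<mu>1\<close> minus \<beta> times the
  lower bound at \<open>\<mu>0\<close>. The terms in \<open>D\<close> leave the factor \<alpha> -
  \<beta> = 1, and \<open>D\<close> dominates the squared distance of the endpoints.\<close>

lemma extrapolation_functional_convex:
  fixes \<mu>0 \<mu>1 \<rho>0 \<rho>1 :: "'a::euclidean_space measure"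
  assumes \<mu>: "\<mu>0 \<in> P2" "\<mu>1 \<in> P2" and \<rho>: "\<rho>0 \<in> P2" "\<rho>1 \<in> P2" and t: "0 \<le> t" "t \<le> 1" and "0 < \<epsilon>"
    and "0 \<le> \<beta>" "\<alpha> = \<beta> + 1"
  defines "F \<equiv> extrapolation_functional \<alpha> \<beta> \<mu>0 \<mu>1"
  shows "\<exists>\<rho>\<in>P2. F \<rho> \<le> (1 - t) * F \<rho>0 + t * F \<rho>1 - t * (1 - t) * (W2 \<rho>0 \<rho>1)\<^sup>2 + \<epsilon>"
proof -
  have "0 < \<alpha>" "0 < \<epsilon> / \<alpha>" using assms by auto
  obtain \<rho> D where \<rho>': "\<rho> \<in> P2" and D: "(W2 \<rho>0 \<rho>1)\<^sup>2 \<le> D"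
    and 1: "(W2 \<rho> \<mu>1)\<^sup>2 + t * (1 - t) * D \<le> (1 - t) * (W2 \<rho>0 \<mu>1)\<^sup>2 + t * (W2 \<rho>1 \<mu>1)\<^sup>2 + \<epsilon> / \<alpha>"
    and 2: "(1 - t) * (W2 \<rho>0 \<mu>0)\<^sup>2 + t * (W2 \<rho>1 \<mu>0)\<^sup>2 \<le> (W2 \<rho> \<mu>0)\<^sup>2 + t * (1 - t) * D"
    using W2_interpolation[OF \<rho> \<mu>(2) t \<open>0 < \<epsilon> / \<alpha>\<close>] \<mu>(1) by metis
  have "\<alpha> * ((W2 \<rho> \<mu>1)\<^sup>2 + t * (1 - t) * D) \<le> \<alpha> * ((1 - t) * (W2 \<rho>0 \<mu>1)\<^sup>2 + t * (W2 \<rho>1 \<mu>1)\<^sup>2) + \<epsilon>"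
    using mult_left_mono[OF 1, of \<alpha>] \<open>0 < \<alpha>\<close> by (simp add: distrib_left)
  moreover have "\<beta> * ((1 - t) * (W2 \<rho>0 \<mu>0)\<^sup>2 + t * (W2 \<rho>1 \<mu>0)\<^sup>2) \<le> \<beta> * ((W2 \<rho> \<mu>0)\<^sup>2 + t * (1 - t) * D)"
    using mult_left_mono[OF 2 \<open>0 \<le> \<beta>\<close>] .
  moreover have "t * (1 - t) * (W2 \<rho>0 \<rho>1)\<^sup>2 \<le> t * (1 - t) * D"
    using D t by (intro mult_left_mono) auto
  ultimately have "F \<rho> \<le> (1 - t) * F \<rho>0 + t * F \<rho>1 - t * (1 - t) * (W2 \<rho>0 \<rho>1)\<^sup>2 + \<epsilon>"
    unfolding F_def extrapolation_functional_def \<open>\<alpha> = \<beta> + 1\<close> by (simp add: algebra_simps)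
  with \<rho>' show ?thesis by blast
qed

section \<open>Markov chains and completeness\<close>

text \<open>The Ionescu-Tulcea theorem realizes a whole sequence of laws on one space, with
  consecutive coordinates coupled by the given kernels.\<close>

lemma markov_chain:
  fixes \<rho> :: "nat \<Rightarrow> 'a::euclidean_space measure" and K :: "nat \<Rightarrow> 'a \<Rightarrow> 'a measure"
  assumes \<rho>: "prob_space (\<rho> 0)" "\<And>n. sets (\<rho> n) = sets borel"
    and K [measurable]: "\<And>n. K n \<in> borel \<rightarrow>\<^sub>M subprob_algebra borel"
    and prob_K: "\<And>n x. prob_space (K n x)"
    and bind_K: "\<And>n. \<rho> n \<bind> K n = \<rho> (Suc n)"
  obtains L :: "(nat \<Rightarrow> 'a) measure"
  where "prob_space L" "\<And>n. (\<lambda>\<omega>. \<omega> n) \<in> borel_measurable L" "\<And>n. distr L borel (\<lambda>\<omega>. \<omega> n) = \<rho> n"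
    "\<And>n g. g \<in> borel_measurable (borel \<Otimes>\<^sub>M borel) \<Longrightarrow>
      (\<integral>\<^sup>+\<omega>. g (\<omega> n, \<omega> (Suc n)) \<partial>L) = (\<integral>\<^sup>+x. \<integral>\<^sup>+y. g (x, y) \<partial>K n x \<partial>\<rho> n)"
proof -
  define M :: "nat \<Rightarrow> 'a measure" where "M = (\<lambda>_. borel)"
  \<comment> \<open>Stage 0 draws from the initial law, so coordinate \<open>Suc m\<close> is drawn
    by \<open>K m\<close> from coordinate \<open>m\<close> alone.\<close>
  define P where "P n \<omega> = (case n of 0 \<Rightarrow> \<rho> 0 | Suc m \<Rightarrow> K m (\<omega> m))" for n and \<omega> :: "nat \<Rightarrow> 'a"
  have sets_K [measurable_cong]: "sets (K n x) = sets borel" for n x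
    using subprob_measurableD(2)[OF K, of x] by simp
  have P_0: "P 0 \<omega> = \<rho> 0" and P_Suc: "P (Suc n) \<omega> = K n (\<omega> n)" for n \<omega>
    by (simp_all add: P_def)
  note \<rho>(2) [measurable_cong]
  have \<rho>0_in: "\<rho> 0 \<in> space (subprob_algebra borel)"
    using \<rho> by (simp add: space_subprob_algebra prob_space_imp_subprob_space)
  have comp [measurable]: "(\<lambda>\<omega>. \<omega> n) \<in> Pi\<^sub>M {0..<N} M \<rightarrow>\<^sub>M borel" if "n < N" for n N
    using measurable_component_singleton[of n "{0..<N}" M] that by (simp add: M_def)
  have "Ionescu_Tulcea P M"
  proof (rule Ionescu_Tulcea.intro)
    fix i
    show "P i \<in> Pi\<^sub>M {0..<i} M \<rightarrow>\<^sub>M subprob_algebra (M i)"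
    proof (cases i)
      case 0
      then show ?thesis using \<rho>0_in by (simp add: P_def[abs_def] M_def)
    next
      case (Suc m)
      have "(\<lambda>\<omega>. K m (\<omega> m)) \<in> Pi\<^sub>M {0..<Suc m} M \<rightarrow>\<^sub>M subprob_algebra borel"
        by (rule measurable_compose[OF comp K]) simp
      then show ?thesis using Suc by (simp add: P_def[abs_def] M_def)
    qed
    show "prob_space (P i x)" if "x \<in> space (Pi\<^sub>M {0..<i} M)" for x
      using \<rho>(1) prob_K by (auto simp: P_def split: nat.split)
  qed
  then interpret Ionescu_Tulcea P M .
  \<comment> \<open>The only point of the product over the empty index set, where the chain
    starts.\<close>
  let ?u = "\<lambda>_. undefined :: 'a"
  have u: "?u \<in> space (Pi\<^sub>M {0..<0} M)" by (simp add: space_PiM)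
  have int_C_Suc: "(\<integral>\<^sup>+\<omega>. g \<omega> \<partial>C 0 (Suc n) ?u) = (\<integral>\<^sup>+\<omega>. \<integral>\<^sup>+y. g (fun_upd \<omega> n y) \<partial>P n \<omega> \<partial>C 0 n ?u)"
    if [measurable]: "g \<in> borel_measurable (Pi\<^sub>M {0..<Suc n} M)" for g n
  proof -
    have eP: "eP n \<in> C 0 n ?u \<rightarrow>\<^sub>M subprob_algebra (Pi\<^sub>M {0..<Suc n} M)"
      using measurable_eP[of n] unfolding measurable_cong_sets[OF sets_C[OF u, of n, unfolded add_0] refl] .
    have "(\<integral>\<^sup>+\<omega>. g \<omega> \<partial>C 0 (Suc n) ?u) = (\<integral>\<^sup>+\<omega>. \<integral>\<^sup>+\<omega>'. g \<omega>' \<partial>eP n \<omega> \<partial>C 0 n ?u)"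
      using nn_integral_bind[OF that eP] by simp
    also have "\<dots> = (\<integral>\<^sup>+\<omega>. \<integral>\<^sup>+y. g (fun_upd \<omega> n y) \<partial>P n \<omega> \<partial>C 0 n ?u)"
      using space_C[OF u, of n] by (intro nn_integral_cong nn_integral_eP) auto
    finally show ?thesis .
  qed
  have marginal: "(\<integral>\<^sup>+\<omega>. g (\<omega> n) \<partial>C 0 (Suc n) ?u) = (\<integral>\<^sup>+x. g x \<partial>\<rho> n)"
    if "g \<in> borel_measurable borel" for g n
    using that
  \<comment> \<open>Integrating out the newest coordinate turns \<open>g\<close> into another
    function of the preceding one, so \<open>g\<close> has to vary in the induction.\<close>
  proof (induction n arbitrary: g)
    case 0
    have "(\<lambda>\<omega>. g (\<omega> 0)) \<in> borel_measurable (Pi\<^sub>M {0..<Suc 0} M)"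
      by (rule measurable_compose[OF comp 0]) simp
    note int_C_Suc[OF this]
    then show ?case
      using u by (simp add: P_0 P_Suc nn_integral_return del: C.simps(2))
  next
    case (Suc n)
    note Suc.prems [measurable]
    have "(\<integral>\<^sup>+\<omega>. g (\<omega> (Suc n)) \<partial>C 0 (Suc (Suc n)) ?u) = (\<integral>\<^sup>+\<omega>. \<integral>\<^sup>+y. g y \<partial>K n (\<omega> n) \<partial>C 0 (Suc n) ?u)"
      by (subst int_C_Suc[OF measurable_compose[OF comp Suc.prems]]) (auto simp: P_0 P_Suc simp del: C.simps)
    also have "\<dots> = (\<integral>\<^sup>+x. \<integral>\<^sup>+y. g y \<partial>K n x \<partial>\<rho> n)"
      by (rule Suc.IH) (rule nn_integral_measurable_subprob_algebra2[where N=borel], auto)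
    also have "\<dots> = (\<integral>\<^sup>+y. g y \<partial>(\<rho> n \<bind> K n))"
      by (rule nn_integral_bind[symmetric, OF Suc.prems])
        (simp add: measurable_cong_sets[OF \<rho>(2) refl])
    finally show ?case by (simp only: bind_K)
  qed
  have pair: "(\<integral>\<^sup>+\<omega>. g (\<omega> n, \<omega> (Suc n)) \<partial>C 0 (Suc (Suc n)) ?u) = (\<integral>\<^sup>+x. \<integral>\<^sup>+y. g (x, y) \<partial>K n x \<partial>\<rho> n)"
    if [measurable]: "g \<in> borel_measurable (borel \<Otimes>\<^sub>M borel)" for g n
  proof -
    have "(\<integral>\<^sup>+\<omega>. g (\<omega> n, \<omega> (Suc n)) \<partial>C 0 (Suc (Suc n)) ?u)
        = (\<integral>\<^sup>+\<omega>. \<integral>\<^sup>+y. g (\<omega> n, y) \<partial>K n (\<omega> n) \<partial>C 0 (Suc n) ?u)"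
      by (subst int_C_Suc[OF measurable_compose[OF _ that]]) (auto simp: P_0 P_Suc simp del: C.simps)
    also have "\<dots> = (\<integral>\<^sup>+x. \<integral>\<^sup>+y. g (x, y) \<partial>K n x \<partial>\<rho> n)"
      by (rule marginal) (rule nn_integral_measurable_subprob_algebra2[where N=borel], auto)
    finally show ?thesis .
  qed
  \<comment> \<open>Carries integrals of functions of the first \<open>N\<close> coordinates from
    the finite chain to the projective limit.\<close>
  have lim_C: "(\<integral>\<^sup>+\<omega>. g (restrict \<omega> {0..<N}) \<partial>PF.lim) = (\<integral>\<^sup>+\<omega>. g (restrict \<omega> {0..<N}) \<partial>C 0 N ?u)"
    if [measurable]: "g \<in> borel_measurable (Pi\<^sub>M {0..<N} M)" for g N
  proof -
    have "up_to {0..<N} = N"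
      using up_to[of "{0..<N}"] by (intro antisym) (auto simp: up_to_iff)
    then have CI: "CI {0..<N} = distr (C 0 N ?u) (Pi\<^sub>M {0..<N} M) (\<lambda>\<omega>. restrict \<omega> {0..<N})"
      by (simp add: CI_def)
    have m1: "(\<lambda>\<omega>. restrict \<omega> {0..<N}) \<in> PF.lim \<rightarrow>\<^sub>M Pi\<^sub>M {0..<N} M"
      by (subst measurable_cong_sets[OF PF.sets_lim refl]) (auto intro!: measurable_restrict_subset)
    have m2: "(\<lambda>\<omega>. restrict \<omega> {0..<N}) \<in> C 0 N ?u \<rightarrow>\<^sub>M Pi\<^sub>M {0..<N} M"
      using sets_C[OF u, of N] by (subst measurable_cong_sets[OF _ refl]) (auto intro!: measurable_restrict_subset)
    show ?thesis
      using nn_integral_distr[OF m1, of g] nn_integral_distr[OF m2, of g] that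
      by (simp add: distr_lim CI)
  qed
  have comp_lim [measurable]: "(\<lambda>\<omega>. \<omega> n) \<in> borel_measurable PF.lim" for n
    using measurable_component_singleton[of n UNIV M]
    by (subst measurable_cong_sets[OF PF.sets_lim refl]) (simp add: M_def)
  show thesis
  proof
    \<comment> \<open>The image of the limit on the empty index set is a probability measure, so the
      limit has total mass 1.\<close>
    show "prob_space PF.lim"
      using distr_lim[of "{}"] PF.prob_space_P[of "{}"]
      by (intro prob_space_distrD[of "\<lambda>\<omega>. restrict \<omega> {}" PF.lim "Pi\<^sub>M {} M"])
        (auto simp: measurable_cong_sets[OF PF.sets_lim refl] intro!: measurable_restrict)
    show "(\<lambda>\<omega>. \<omega> n) \<in> borel_measurable PF.lim" for n by measurable
    have 1: "(\<integral>\<^sup>+\<omega>. g (\<omega> n) \<partial>PF.lim) = (\<integral>\<^sup>+x. g x \<partial>\<rho> n)"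
      if [measurable]: "g \<in> borel_measurable borel" for g n
      using lim_C[of "\<lambda>\<omega>. g (\<omega> n)" "Suc n"] marginal[of g n] by simp
    show "distr PF.lim borel (\<lambda>\<omega>. \<omega> n) = \<rho> n" for n
    proof (rule measure_eqI)
      fix A :: "'a set" assume "A \<in> sets (distr PF.lim borel (\<lambda>\<omega>. \<omega> n))"
      then have [measurable]: "A \<in> sets borel" by simp
      have "emeasure (distr PF.lim borel (\<lambda>\<omega>. \<omega> n)) A = (\<integral>\<^sup>+\<omega>. indicator A (\<omega> n) \<partial>PF.lim)"
        by (subst nn_integral_indicator[symmetric]) (auto simp: nn_integral_distr simp del: nn_integral_indicator)
      then show "emeasure (distr PF.lim borel (\<lambda>\<omega>. \<omega> n)) A = emeasure (\<rho> n) A"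
        by (simp add: 1)
    qed (simp add: \<rho>)
    show "(\<integral>\<^sup>+\<omega>. g (\<omega> n, \<omega> (Suc n)) \<partial>PF.lim) = (\<integral>\<^sup>+x. \<integral>\<^sup>+y. g (x, y) \<partial>K n x \<partial>\<rho> n)"
      if [measurable]: "g \<in> borel_measurable (borel \<Otimes>\<^sub>M borel)" for g n
      using lim_C[of "\<lambda>\<omega>. g (\<omega> n, \<omega> (Suc n))" "Suc (Suc n)"] pair[of g n] by simp
  qed
qed

lemma W2_self:
  fixes \<mu> :: "'a::euclidean_space measure"
  assumes "\<mu> \<in> P2"
  shows "W2 \<mu> \<mu> = 0"
proof -
  note P2D(2)[OF assms, measurable_cong]
  have "distr \<mu> borel (\<lambda>x. x) = \<mu>"
    by (rule distr_id2) (simp add: P2D(2)[OF assms])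
  then show ?thesis
    using W2_power2_le[OF P2D(1)[OF assms], of "\<lambda>x. x" "\<lambda>x. x"] by simp
qed

text \<open>Along a Markov chain of nearly optimal kernels the expected path length is finite, so
  almost every path converges; the law of the pathwise limit is the limit in \<open>W2\<close>. The
  geometric rate is the one later imposed on a minimizing sequence.\<close>

lemma W2_complete:
  fixes \<rho> :: "nat \<Rightarrow> 'a::euclidean_space measure"
  assumes \<rho>: "\<And>n. \<rho> n \<in> P2" and W: "\<And>n. W2 (\<rho> n) (\<rho> (Suc n)) \<le> (1/2) ^ n"
  obtains \<rho>' where "\<rho>' \<in> P2" "(\<lambda>n. W2 (\<rho> n) \<rho>') \<longlonglongrightarrow> 0"
proof -
  have "\<exists>K. K \<in> borel \<rightarrow>\<^sub>M subprob_algebra borel \<and> (\<forall>x. prob_space (K x)) \<and> \<rho> n \<bind> K = \<rho> (Suc n) \<and>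
      (\<integral>\<^sup>+x. \<integral>\<^sup>+y. ennreal ((dist x y)\<^sup>2) \<partial>K x \<partial>\<rho> n) \<le> ennreal ((W2 (\<rho> n) (\<rho> (Suc n)) + (1/2)^n)\<^sup>2)" for n
    by (rule near_optimal_kernel[OF \<rho>[of n] \<rho>[of "Suc n"], of "(1/2)^n"]) (simp, blast)
  then have "\<exists>K. \<forall>n. K n \<in> borel \<rightarrow>\<^sub>M subprob_algebra borel \<and> (\<forall>x. prob_space (K n x))
      \<and> \<rho> n \<bind> K n = \<rho> (Suc n)
      \<and> (\<integral>\<^sup>+x. \<integral>\<^sup>+y. ennreal ((dist x y)\<^sup>2) \<partial>K n x \<partial>\<rho> n) \<le> ennreal ((W2 (\<rho> n) (\<rho> (Suc n)) + (1/2)^n)\<^sup>2)"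
    by (intro choice allI)
  then obtain K where K: "\<And>n. K n \<in> borel \<rightarrow>\<^sub>M subprob_algebra borel" "\<And>n x. prob_space (K n x)"
      "\<And>n. \<rho> n \<bind> K n = \<rho> (Suc n)"
    and cost: "\<And>n. (\<integral>\<^sup>+x. \<integral>\<^sup>+y. ennreal ((dist x y)\<^sup>2) \<partial>K n x \<partial>\<rho> n)
      \<le> ennreal ((W2 (\<rho> n) (\<rho> (Suc n)) + (1/2)^n)\<^sup>2)"
    by blast
  obtain L :: "(nat \<Rightarrow> 'a) measure" where L: "prob_space L"
    and [measurable]: "\<And>n. (\<lambda>\<omega>. \<omega> n) \<in> borel_measurable L"
    and law: "\<And>n. distr L borel (\<lambda>\<omega>. \<omega> n) = \<rho> n"
    and pair: "\<And>n g. g \<in> borel_measurable (borel \<Otimes>\<^sub>M borel) \<Longrightarrow>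
      (\<integral>\<^sup>+\<omega>. g (\<omega> n, \<omega> (Suc n)) \<partial>L) = (\<integral>\<^sup>+x. \<integral>\<^sup>+y. g (x, y) \<partial>K n x \<partial>\<rho> n)"
    using markov_chain[of \<rho> K, OF P2D(1)[OF \<rho>] P2D(2)[OF \<rho>] K] by blast
  interpret prob_space L by fact
  have step_le: "(\<integral>\<^sup>+\<omega>. ennreal ((dist (\<omega> n) (\<omega> (Suc n)))\<^sup>2) \<partial>L) \<le> ennreal ((2 * (1/2)^n)\<^sup>2)" for n
  proof -
    have "(\<integral>\<^sup>+\<omega>. ennreal ((dist (\<omega> n) (\<omega> (Suc n)))\<^sup>2) \<partial>L) \<le> ennreal ((W2 (\<rho> n) (\<rho> (Suc n)) + (1/2)^n)\<^sup>2)"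
      using pair[of "\<lambda>z. ennreal ((dist (fst z) (snd z))\<^sup>2)" n] cost[of n] by simp
    also have "\<dots> \<le> ennreal ((2 * (1/2)^n)\<^sup>2)"
      using W[of n] W2_nonneg[of "\<rho> n" "\<rho> (Suc n)"] by (intro ennreal_leI power_mono) auto
    finally show ?thesis .
  qed
  have tail: "(\<integral>\<^sup>+\<omega>. ennreal ((dist (\<omega> n) (\<omega> m))\<^sup>2) \<partial>L) \<le> ennreal ((4 * (1/2)^n)\<^sup>2)" if "n \<le> m" for n m
  proof -
    \<comment> \<open>The sharper bound with the subtracted term closes the induction: a step adds
      \<open>2 * (1/2)^m\<close>, which is exactly its increment.\<close>
    have "(\<integral>\<^sup>+\<omega>. ennreal ((dist (\<omega> n) (\<omega> m))\<^sup>2) \<partial>L) \<le> ennreal ((4 * (1/2)^n - 4 * (1/2)^m)\<^sup>2)"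
      using that
    proof (induction m rule: dec_induct)
      case (step m)
      have "(1/2::real)^m \<le> (1/2)^n"
        using step(1) by (intro power_decreasing) auto
      then have "(\<integral>\<^sup>+\<omega>. ennreal ((dist (\<omega> n) (\<omega> (Suc m)))\<^sup>2) \<partial>L)
          \<le> ennreal (((4 * (1/2)^n - 4 * (1/2)^m) + 2 * (1/2)^m)\<^sup>2)"
        by (intro nn_integral_dist_triangle[OF _ _ _ step(3) _ step_le]) auto
      then show ?case by simp
    qed simp
    also have "\<dots> \<le> ennreal ((4 * (1/2)^n)\<^sup>2)"
      using that by (intro ennreal_leI power_mono) (auto intro!: power_decreasing)
    finally show ?thesis .
  qed
  \<comment> \<open>First moments come from second ones by d \<le> q + d*d/q with q =
    \<open>(1/2)^n\<close>; the integral is then at most q + 4q.\<close>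
  have "(\<integral>\<^sup>+\<omega>. ennreal (dist (\<omega> n) (\<omega> (Suc n))) \<partial>L) \<le> ennreal (5 * (1/2)^n)" for n
  proof -
    have "(\<integral>\<^sup>+\<omega>. ennreal (dist (\<omega> n) (\<omega> (Suc n))) \<partial>L)
        \<le> (\<integral>\<^sup>+\<omega>. ennreal ((1/2)^n) + ennreal (2^n) * ennreal ((dist (\<omega> n) (\<omega> (Suc n)))\<^sup>2) \<partial>L)"
    proof (rule nn_integral_mono)
      fix \<omega> :: "nat \<Rightarrow> 'a"
      let ?d = "dist (\<omega> n) (\<omega> (Suc n))"
      have "0 \<le> (2^n * ?d - 1)\<^sup>2 + 2^n * ?d" by simp
      also have "\<dots> = 2^n * ((1/2)^n + 2^n * ?d\<^sup>2 - ?d)"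
      proof -
        have "(p * d - 1)\<^sup>2 + p * d = p * (q + p * d\<^sup>2 - d)" if "p * q = 1" for p q d :: real
          using that by (simp add: power2_eq_square algebra_simps)
        then show ?thesis by (simp flip: power_mult_distrib)
      qed
      finally have "?d \<le> (1/2)^n + 2^n * ?d\<^sup>2"
        by (simp add: zero_le_mult_iff power_le_zero_eq)
      then show "ennreal ?d \<le> ennreal ((1/2)^n) + ennreal (2^n) * ennreal (?d\<^sup>2)"
        by (simp flip: ennreal_mult ennreal_plus)
    qed
    also have "\<dots> = ennreal ((1/2)^n) + ennreal (2^n) * (\<integral>\<^sup>+\<omega>. ennreal ((dist (\<omega> n) (\<omega> (Suc n)))\<^sup>2) \<partial>L)"
      by (simp add: nn_integral_add nn_integral_cmult emeasure_space_1)
    also have "\<dots> \<le> ennreal ((1/2)^n) + ennreal (2^n) * ennreal ((2 * (1/2)^n)\<^sup>2)"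
      by (intro add_left_mono mult_left_mono step_le) simp
    also have "\<dots> = ennreal ((1/2)^n + 2^n * (2 * (1/2)^n)\<^sup>2)"
      by (simp flip: ennreal_mult ennreal_plus)
    also have "(1/2)^n + 2^n * (2 * (1/2)^n)\<^sup>2 = (5 * (1/2)^n :: real)"
      by (simp add: power2_eq_square power_divide)
    finally show ?thesis .
  qed
  then have "(\<Sum>n. \<integral>\<^sup>+\<omega>. ennreal (dist (\<omega> n) (\<omega> (Suc n))) \<partial>L) \<le> (\<Sum>n. ennreal (5 * (1/2)^n))"
    by (intro suminf_le) auto
  also have "\<dots> < \<infinity>"
    by (subst suminf_ennreal2) (auto intro!: summable_mult summable_geometric)
  finally have "(\<integral>\<^sup>+\<omega>. (\<Sum>n. ennreal (dist (\<omega> n) (\<omega> (Suc n)))) \<partial>L) \<noteq> \<infinity>"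
    by (subst nn_integral_suminf) auto
  then have "AE \<omega> in L. (\<Sum>n. ennreal (dist (\<omega> n) (\<omega> (Suc n)))) \<noteq> \<infinity>"
    by (intro nn_integral_PInf_AE) auto
  \<comment> \<open>On paths of finite length the increments are absolutely summable, and their
    partial sums telescope to the path.\<close>
  then have conv: "AE \<omega> in L. (\<lambda>n. \<omega> n) \<longlonglongrightarrow> lim (\<lambda>n. \<omega> n)"
  proof eventually_elim
    case (elim \<omega>)
    then have "summable (\<lambda>n. dist (\<omega> n) (\<omega> (Suc n)))"
      by (intro summable_suminf_not_top) auto
    then have "summable (\<lambda>n. \<omega> (Suc n) - \<omega> n)"
      unfolding dist_norm norm_minus_commute[of "\<omega> _" "\<omega> (Suc _)"] by (rule summable_norm_cancel)
    then have "convergent (\<lambda>n. (\<Sum>k<n. \<omega> (Suc k) - \<omega> k) + \<omega> 0)"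
      unfolding summable_iff_convergent by (rule convergent_add[OF _ convergent_const])
    then show ?case
      unfolding sum_lessThan_telescope by (simp add: convergent_LIMSEQ_iff)
  qed
  define X where "X \<omega> = lim (\<lambda>n. \<omega> n)" for \<omega> :: "nat \<Rightarrow> 'a"
  have [measurable]: "X \<in> borel_measurable L"
    unfolding X_def by measurable
  have lim_le: "(\<integral>\<^sup>+\<omega>. ennreal ((dist (\<omega> n) (X \<omega>))\<^sup>2) \<partial>L) \<le> ennreal ((4 * (1/2)^n)\<^sup>2)" for n
  proof -
    \<comment> \<open>Written as a lower limit in \<open>m\<close>, so that Fatou's lemma passes the
      bound \<open>tail\<close> on to \<open>X\<close>.\<close>
    have "AE \<omega> in L. ennreal ((dist (\<omega> n) (X \<omega>))\<^sup>2) = liminf (\<lambda>m. ennreal ((dist (\<omega> n) (\<omega> m))\<^sup>2))"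
      using conv
    proof eventually_elim
      case (elim \<omega>)
      then have "(\<lambda>m. ennreal ((dist (\<omega> n) (\<omega> m))\<^sup>2)) \<longlonglongrightarrow> ennreal ((dist (\<omega> n) (X \<omega>))\<^sup>2)"
        unfolding X_def by (intro tendsto_intros)
      then show ?case by (intro lim_imp_Liminf[symmetric]) auto
    qed
    then have "(\<integral>\<^sup>+\<omega>. ennreal ((dist (\<omega> n) (X \<omega>))\<^sup>2) \<partial>L)
        = (\<integral>\<^sup>+\<omega>. liminf (\<lambda>m. ennreal ((dist (\<omega> n) (\<omega> m))\<^sup>2)) \<partial>L)"
      by (rule nn_integral_cong_AE)
    also have "\<dots> \<le> liminf (\<lambda>m. \<integral>\<^sup>+\<omega>. ennreal ((dist (\<omega> n) (\<omega> m))\<^sup>2) \<partial>L)"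
      by (rule nn_integral_liminf) measurable
    also have "\<dots> \<le> limsup (\<lambda>m. \<integral>\<^sup>+\<omega>. ennreal ((dist (\<omega> n) (\<omega> m))\<^sup>2) \<partial>L)"
      by (rule Liminf_le_Limsup) simp
    also have "\<dots> \<le> ennreal ((4 * (1/2)^n)\<^sup>2)"
      using tail[of n] by (intro Limsup_bounded) (auto simp: eventually_sequentially)
    finally show ?thesis .
  qed
  show thesis
  proof
    \<comment> \<open>The second moment of \<open>X\<close> is controlled by that of coordinate 0
      and the distance between the two.\<close>
    define r where "r = enn2real (\<integral>\<^sup>+\<omega>. ennreal ((dist (\<omega> 0) 0)\<^sup>2) \<partial>L)"
    have "(\<integral>\<^sup>+\<omega>. ennreal ((dist (\<omega> 0) 0)\<^sup>2) \<partial>L) < \<infinity>"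
      using P2D(4)[OF \<rho>[of 0]] by (simp add: nn_integral_distr flip: law)
    then have r: "(\<integral>\<^sup>+\<omega>. ennreal ((dist (\<omega> 0) 0)\<^sup>2) \<partial>L) \<le> ennreal ((sqrt r)\<^sup>2)"
      by (simp add: r_def)
    have "(\<integral>\<^sup>+\<omega>. ennreal ((dist (X \<omega>) 0)\<^sup>2) \<partial>L) \<le> ennreal ((4 * (1/2)^0 + sqrt r)\<^sup>2)"
      using lim_le[of 0] by (intro nn_integral_dist_triangle[OF _ _ _ _ _ r]) (auto simp: dist_commute r_def)
    then show "distr L borel X \<in> P2"
      by (intro distr_in_P2 L) (auto simp: less_top[symmetric] dest: neq_top_trans[rotated])
    have "W2 (\<rho> n) (distr L borel X) \<le> 4 * (1/2)^n" for n
      unfolding law[symmetric] using lim_le[of n] by (intro W2_le L) auto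
    then have "\<forall>\<^sub>F n in sequentially. norm (W2 (\<rho> n) (distr L borel X)) \<le> 4 * (1/2)^n"
      by (simp add: W2_nonneg)
    moreover have "(\<lambda>n. 4 * (1/2)^n :: real) \<longlonglongrightarrow> 0"
      by (intro tendsto_mult_right_zero LIMSEQ_power_zero) simp
    ultimately show "(\<lambda>n. W2 (\<rho> n) (distr L borel X)) \<longlonglongrightarrow> 0"
      by (rule Lim_null_comparison)
  qed
qed

lemma W2_tendsto:
  fixes \<rho> :: "nat \<Rightarrow> 'a::euclidean_space measure"
  assumes \<rho>: "\<And>n. \<rho> n \<in> P2" "\<rho>' \<in> P2" "\<nu> \<in> P2" and lim: "(\<lambda>n. W2 (\<rho> n) \<rho>') \<longlonglongrightarrow> 0"
  shows "(\<lambda>n. W2 (\<rho> n) \<nu>) \<longlonglongrightarrow> W2 \<rho>' \<nu>"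
proof (rule LIM_zero_cancel, rule Lim_null_comparison[OF _ lim], intro always_eventually allI)
  fix n
  show "norm (W2 (\<rho> n) \<nu> - W2 \<rho>' \<nu>) \<le> W2 (\<rho> n) \<rho>'"
    using W2_triangle[OF \<rho>(1)[of n] \<rho>(2,3)] W2_triangle[OF \<rho>(2) \<rho>(1)[of n] \<rho>(3)] W2_commute[OF \<rho>(1)[of n] \<rho>(2)]
    by simp
qed

section \<open>Existence of a minimizer and the variational inequality\<close>

text \<open>The direct method, with convexity in place of compactness: it makes a minimizing
  sequence Cauchy, and the functional is continuous along sequences converging in
  \<open>W2\<close>.\<close>

lemma metric_extrapolation_exists:
  fixes \<mu>0 \<mu>1 :: "'a::euclidean_space measure"
  assumes \<mu>: "\<mu>0 \<in> P2" "\<mu>1 \<in> P2" and "0 \<le> \<beta>" "\<alpha> = \<beta> + 1"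
  obtains \<rho> where "is_metric_extrapolation \<alpha> \<beta> \<mu>0 \<mu>1 \<rho>"
proof -
  define F where "F = extrapolation_functional \<alpha> \<beta> \<mu>0 \<mu>1"
  define m where "m = Inf (F ` P2)"
  define c where "c = W2 \<mu>1 \<mu>0"
  \<comment> \<open>With a = \<open>?a\<close> and b \<le> a + c, completing the square gives
    (\<beta> + 1)aa - \<beta>(a + c)(a + c) = (a - \<beta>c)(a - \<beta>c) - (\<beta>c)(\<beta>c) -
    \<beta>cc. A lower bound is what makes the real infimum \<open>m\<close> meaningful.\<close>
  have lower: "- (\<beta> * c)\<^sup>2 - \<beta> * c\<^sup>2 \<le> F \<rho>" if "\<rho> \<in> P2" for \<rho>
  proof -
    let ?a = "W2 \<rho> \<mu>1" and ?b = "W2 \<rho> \<mu>0"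
    have "?b\<^sup>2 \<le> (?a + c)\<^sup>2"
      unfolding c_def using W2_triangle[OF that \<mu>(2,1)] by (intro power_mono W2_nonneg) simp
    then have "\<beta> * ?b\<^sup>2 \<le> \<beta> * (?a + c)\<^sup>2"
      using \<open>0 \<le> \<beta>\<close> by (rule mult_left_mono)
    moreover have "0 \<le> (?a - \<beta> * c)\<^sup>2" by simp
    ultimately show ?thesis
      unfolding F_def extrapolation_functional_def \<open>\<alpha> = \<beta> + 1\<close>
      by (simp add: power2_eq_square algebra_simps)
  qed
  then have bdd: "bdd_below (F ` P2)" by (auto intro!: bdd_belowI2)
  have m_le: "m \<le> F \<rho>" if "\<rho> \<in> P2" for \<rho>
    unfolding m_def using that bdd by (rule cINF_lower[rotated])
  \<comment> \<open>With these gaps the midpoint estimate gives squared steps of at most (2/8 +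
    2/32) \<open>(1/4)^n\<close>, within the rate \<open>(1/2)^n\<close> required for
    completeness.\<close>
  have "\<exists>\<rho>\<in>P2. F \<rho> < m + (1/4)^n / 8" for n
    unfolding m_def using \<mu>(1) by (subst cINF_less_iff[OF _ bdd, symmetric]) auto
  then obtain \<rho> where \<rho>: "\<And>n. \<rho> n \<in> P2" and F_\<rho>: "\<And>n. F (\<rho> n) < m + (1/4)^n / 8"
    by metis
  have "W2 (\<rho> n) (\<rho> (Suc n)) \<le> (1/2)^n" for n
  proof (rule power2_le_imp_le)
    \<comment> \<open>Convexity at t = 1/2, where the value at the approximate midpoint is at least
      \<open>m\<close>, multiplied by 4.\<close>
    have "(W2 (\<rho> n) (\<rho> (Suc n)))\<^sup>2 \<le> 2 * (F (\<rho> n) - m) + 2 * (F (\<rho> (Suc n)) - m)"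
    proof (rule field_le_epsilon)
      fix e :: real assume "0 < e"
      then obtain \<sigma> where "\<sigma> \<in> P2" and \<sigma>: "F \<sigma> \<le> (1 - 1/2) * F (\<rho> n) + 1/2 * F (\<rho> (Suc n))
          - 1/2 * (1 - 1/2) * (W2 (\<rho> n) (\<rho> (Suc n)))\<^sup>2 + e/4"
        using extrapolation_functional_convex[OF \<mu> \<rho>[of n] \<rho>[of "Suc n"], of "1/2" "e/4" \<beta> \<alpha>] assms(3,4)
        unfolding F_def by auto
      then show "(W2 (\<rho> n) (\<rho> (Suc n)))\<^sup>2 \<le> 2 * (F (\<rho> n) - m) + 2 * (F (\<rho> (Suc n)) - m) + e"
        using m_le[of \<sigma>] by simp
    qed
    also have "\<dots> \<le> (1/4)^n"
    proof -
      have "2 * (x - m) + 2 * (y - m) \<le> q" if "x < m + q / 8" "y < m + q / 32" "0 < q" for x y q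
        using that by (simp add: field_simps)
      from this[OF F_\<rho>[of n]] F_\<rho>[of "Suc n"] show ?thesis by simp
    qed
    also have "\<dots> = ((1/2)^n)\<^sup>2"
      by (simp add: power2_eq_square flip: power_mult_distrib)
    finally show "(W2 (\<rho> n) (\<rho> (Suc n)))\<^sup>2 \<le> ((1/2)^n)\<^sup>2" .
  qed simp
  then obtain \<rho>' where \<rho>': "\<rho>' \<in> P2" and lim: "(\<lambda>n. W2 (\<rho> n) \<rho>') \<longlonglongrightarrow> 0"
    using W2_complete[of \<rho>, OF \<rho>] by blast
  have "(\<lambda>n. F (\<rho> n)) \<longlonglongrightarrow> F \<rho>'"
    unfolding F_def extrapolation_functional_def
    by (intro tendsto_intros W2_tendsto \<rho> \<rho>' \<mu> lim)
  moreover have "(\<lambda>n. m + (1/4)^n / 8) \<longlonglongrightarrow> m"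
    by (auto intro!: tendsto_eq_intros LIMSEQ_power_zero)
  ultimately have "F \<rho>' \<le> m"
    using F_\<rho> by (intro LIMSEQ_le) (auto intro: less_imp_le)
  then have "is_metric_extrapolation \<alpha> \<beta> \<mu>0 \<mu>1 \<rho>'"
    using \<rho>' m_le by (fastforce simp: is_metric_extrapolation_def is_arg_min_def F_def)
  then show thesis by (rule that)
qed

lemma metric_extrapolation_variational:
  fixes \<mu>0 \<mu>1 :: "'a::euclidean_space measure"
  assumes \<mu>: "\<mu>0 \<in> P2" "\<mu>1 \<in> P2" and "0 \<le> \<beta>" "\<alpha> = \<beta> + 1"
    and min: "is_metric_extrapolation \<alpha> \<beta> \<mu>0 \<mu>1 \<rho>" and \<nu>: "\<nu> \<in> P2"
  shows "(W2 \<nu> \<rho>)\<^sup>2 + extrapolation_functional \<alpha> \<beta> \<mu>0 \<mu>1 \<rho> \<le> extrapolation_functional \<alpha> \<beta> \<mu>0 \<mu>1 \<nu>"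
proof -
  define F where "F = extrapolation_functional \<alpha> \<beta> \<mu>0 \<mu>1"
  have \<rho>: "\<rho> \<in> P2" and le: "\<And>\<sigma>. \<sigma> \<in> P2 \<Longrightarrow> F \<rho> \<le> F \<sigma>"
    using min by (auto simp: is_metric_extrapolation_def is_arg_min_def F_def not_less)
  have "(1 - t) * (W2 \<rho> \<nu>)\<^sup>2 \<le> F \<nu> - F \<rho>" if "0 < t" "t < 1" for t
  proof -
    \<comment> \<open>For fixed \<open>t\<close> the error \<open>e\<close> is removed first; only
      then is the inequality divided by \<open>t\<close>.\<close>
    have "0 \<le> t * (F \<nu> - F \<rho> - (1 - t) * (W2 \<rho> \<nu>)\<^sup>2)"
    proof (rule field_le_epsilon)
      fix e :: real assume "0 < e"
      then obtain \<sigma> where "\<sigma> \<in> P2" "F \<sigma> \<le> (1 - t) * F \<rho> + t * F \<nu> - t * (1 - t) * (W2 \<rho> \<nu>)\<^sup>2 + e"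
        using extrapolation_functional_convex[OF \<mu> \<rho> \<nu> less_imp_le less_imp_le _ assms(3,4), OF \<open>0 < t\<close> \<open>t < 1\<close>]
        unfolding F_def by blast
      with le[of \<sigma>] show "0 \<le> t * (F \<nu> - F \<rho> - (1 - t) * (W2 \<rho> \<nu>)\<^sup>2) + e"
        by (simp add: algebra_simps)
    qed
    then show ?thesis using that by (simp add: zero_le_mult_iff)
  qed
  then have "eventually (\<lambda>t. (1 - t) * (W2 \<rho> \<nu>)\<^sup>2 \<le> F \<nu> - F \<rho>) (at_right (0::real))"
    by (auto simp: eventually_at_right_field intro!: exI[of _ 1])
  moreover have "((\<lambda>t. (1 - t) * (W2 \<rho> \<nu>)\<^sup>2) \<longlongrightarrow> (W2 \<rho> \<nu>)\<^sup>2) (at_right (0::real))"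
    by (auto intro!: tendsto_eq_intros)
  ultimately have "(W2 \<rho> \<nu>)\<^sup>2 \<le> F \<nu> - F \<rho>"
    by (intro tendsto_upperbound) auto
  then show ?thesis
    by (simp add: F_def W2_commute[OF \<rho> \<nu>])
qed

section \<open>Uniqueness and dissipativity\<close>

theorem proposition4p10:
  fixes \<alpha> \<beta> :: real and \<mu>0 \<mu>1 :: "(real ^ 'd) measure"
  assumes "\<alpha> > 1" and "\<beta> = \<alpha> - 1" and "\<mu>0 \<in> P2" and "\<mu>1 \<in> P2"
  shows "(\<exists>!\<mu>\<alpha>. is_metric_extrapolation \<alpha> \<beta> \<mu>0 \<mu>1 \<mu>\<alpha>) \<and>
    (\<forall>\<mu>\<alpha>. is_metric_extrapolation \<alpha> \<beta> \<mu>0 \<mu>1 \<mu>\<alpha> \<longrightarrow>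
       W2 \<mu>1 \<mu>\<alpha> \<le> \<beta> * W2 \<mu>0 \<mu>1 \<and>
       (\<forall>\<mu>\<in>P2. (W2 \<mu> \<mu>\<alpha>)\<^sup>2 + extrapolation_functional \<alpha> \<beta> \<mu>0 \<mu>1 \<mu>\<alpha>
                 \<le> extrapolation_functional \<alpha> \<beta> \<mu>0 \<mu>1 \<mu>))"
proof (intro conjI allI impI ballI)
  have \<beta>: "0 \<le> \<beta>" "\<alpha> = \<beta> + 1" using assms by auto
  note var = metric_extrapolation_variational[OF assms(3,4) \<beta>]
  have P2: "\<rho> \<in> P2" if "is_metric_extrapolation \<alpha> \<beta> \<mu>0 \<mu>1 \<rho>" for \<rho>
    using that by (simp add: is_metric_extrapolation_def is_arg_min_def)
  show "\<exists>!\<mu>\<alpha>. is_metric_extrapolation \<alpha> \<beta> \<mu>0 \<mu>1 \<mu>\<alpha>"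
  proof (rule ex_ex1I)
    show "\<exists>\<mu>\<alpha>. is_metric_extrapolation \<alpha> \<beta> \<mu>0 \<mu>1 \<mu>\<alpha>"
      using metric_extrapolation_exists[OF assms(3,4) \<beta>] by blast
    fix \<rho> \<sigma>
    assume \<rho>: "is_metric_extrapolation \<alpha> \<beta> \<mu>0 \<mu>1 \<rho>" and \<sigma>: "is_metric_extrapolation \<alpha> \<beta> \<mu>0 \<mu>1 \<sigma>"
    \<comment> \<open>Each minimizer is tested against the other; in the sum of the two inequalities
      the values of the functional cancel.\<close>
    have "(W2 \<rho> \<sigma>)\<^sup>2 \<le> 0"
      using var[OF \<rho> P2[OF \<sigma>]] var[OF \<sigma> P2[OF \<rho>]]
      unfolding W2_commute[OF P2[OF \<rho>] P2[OF \<sigma>]] by linarith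
    then show "\<rho> = \<sigma>"
      by (intro W2_eq_0_imp_eq P2 \<rho> \<sigma>) simp
  qed
  fix \<rho> assume \<rho>: "is_metric_extrapolation \<alpha> \<beta> \<mu>0 \<mu>1 \<rho>"
  show "(W2 \<mu> \<rho>)\<^sup>2 + extrapolation_functional \<alpha> \<beta> \<mu>0 \<mu>1 \<rho> \<le> extrapolation_functional \<alpha> \<beta> \<mu>0 \<mu>1 \<mu>"
    if "\<mu> \<in> P2" for \<mu>
    by (rule var[OF \<rho> that])
  let ?a = "W2 \<mu>1 \<rho>" and ?b = "W2 \<rho> \<mu>0" and ?c = "W2 \<mu>0 \<mu>1"
  have nonneg: "0 \<le> ?a" "0 \<le> ?b" "0 \<le> ?c" by (simp_all add: W2_nonneg)
  have comm: "W2 \<rho> \<mu>1 = ?a" "W2 \<mu>1 \<mu>0 = ?c"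
    using assms P2[OF \<rho>] by (auto intro: W2_commute)
  have "W2 \<mu>1 \<mu>1 = 0"
    by (rule W2_self[OF assms(4)])
  \<comment> \<open>The variational inequality at \<open>\<mu>1\<close>. Inserting b \<le> a + c
    cancels the terms in c*c and leaves 2aa \<le> 2\<beta>ac, which is then divided by a unless a =
    0.\<close>
  then have "?a\<^sup>2 + \<alpha> * ?a\<^sup>2 - \<beta> * ?b\<^sup>2 \<le> - (\<beta> * ?c\<^sup>2)"
    using var[OF \<rho> assms(4)] by (simp add: extrapolation_functional_def comm)
  moreover have "\<beta> * ?b\<^sup>2 \<le> \<beta> * (?a + ?c)\<^sup>2"
    using W2_triangle[OF P2[OF \<rho>] assms(4,3)] nonneg \<beta> by (intro mult_left_mono power_mono) (auto simp: comm)
  ultimately have "?a * ?a \<le> ?a * (\<beta> * ?c)"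
    unfolding \<beta>(2) by (simp add: power2_eq_square algebra_simps)
  then show "?a \<le> \<beta> * ?c"
    using nonneg \<beta> by (cases "?a = 0") (auto simp: mult_le_cancel_left)
qed

end
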